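(* Let $q \geq 3$ be an integer. Let $\mathcal{P}^q$ be the convex hull in $\mathbb{R}^2$ of the points $\mathfrak{w}_0^q, \dots, \mathfrak{w}_{q-1}^q$, with the (closed) line segment joining $\mathfrak{w}_0^q$ and $\mathfrak{w}_{q-1}^q$ removed, and let $$S\mathcal{P}^q := \{(\mathbf{u},\mathbf{v}) \in \widehat{\mathsf{FQ}\times\mathsf{FQ}} \mid \mathbf{u} \in \mathcal{P}^q\}.$$ Then the $G_q$-cosets corresponding to the matrices in $\Phi(S\mathcal{P}^q)$ are bijectively identified with the points of the suspension $S_{R_q}\mathcal{T}^q$ of the horocycle flow on $\mathrm{SL}(2,\mathbb{R})/G_q$ over the $G_q$-Farey triangle $\mathcal{T}^q$; that is, the map $(\mathbf{u},\mathbf{v}) \mapsto \Phi(\mathbf{u},\mathbf{v})G_q$ is a bijection from $S\mathcal{P}^q$ onto the set of cosets $\{h_s g_{a,b} G_q \mid (a,b) \in \mathcal{T}^q,\ 0 \le s < R_q(a,b)\}$. Consequently: (i) the base $\mathcal{P}^q$ of $S\mathcal{P}^q$, regarded as the subset $\{g_{a,b}G_q \mid (a,b)^T \in \mathcal{P}^q\}$ of $\mathrm{SL}(2,\mathbb{R})/G_q$ (i.e. the points $\Phi((a,b)^T,(1/a,0)^T)G_q$), is a cross section to the horocycle flow $(h_s)_{s\in\mathbb{R}}$ on $\mathrm{SL}(2,\mathbb{R})/G_q$; (ii) the open side of $S\mathcal{P}^q$ lying above the line segment joining $\mathfrak{w}_0^q$ and $\mathfrak{w}_{q-1}^q$, i.e.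 the set $\{\Phi(\mathbf{u},\mathbf{v})G_q \mid (\mathbf{u},\mathbf{v})\in\widehat{\mathsf{FQ}\times\mathsf{FQ}},\ \mathbf{u} = (a,1-a)^T,\ 0<a<1\}$, is a cross section to the geodesic flow $(g_t)_{t\in\mathbb{R}}$ on $\mathrm{SL}(2,\mathbb{R})/G_q$.
   Context: Let $q\ge 3$ be an integer and $\lambda_q := 2\cos(\pi/q)$. The Hecke triangle group $G_q$ is the discrete subgroup of $\mathrm{SL}(2,\mathbb{R})$ generated by $S=\begin{pmatrix}0&-1\\1&0\end{pmatrix}$ and $T_q=\begin{pmatrix}1&\lambda_q\\0&1\end{pmatrix}$. Put $U_q:=T_qS=\begin{pmatrix}\lambda_q&-1\\1&0\end{pmatrix}$ and, for $i=0,1,\dots,q-1$, $\mathfrak{w}_i^q=(x_i^q,y_i^q)^T:=U_q^i(1,0)^T$. (So $\mathfrak{w}_0^q=(1,0)^T$, $\mathfrak{w}_1^q=(\lambda_q,1)^T$, $\mathfrak{w}_{q-2}^q=(1,\lambda_q)^T$, $\mathfrak{w}_{q-1}^q=(0,1)^T$.) Matrices: $h_s:=\begin{pmatrix}1&0\\-s&1\end{pmatrix}$, $g_t:=\begin{pmatrix}e^t&0\\0&e^{-t}\end{pmatrix}$ for $s,t\in\mathbb{R}$, and $g_{a,b}:=\begin{pmatrix}a&b\\0&a^{-1}\end{pmatrix}$ for $a>0$, $b\in\mathbb{R}$. The horocycle flow (resp. geodesic flow) on $\mathrm{SL}(2,\mathbb{R})/G_q$ is left multiplication by $(h_s)_{s\in\mathbb{R}}$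 (resp. $(g_t)_{t\in\mathbb{R}}$). $\mathsf{FQ}:=\{(x,y)^T\in\mathbb{R}^2\mid x>0,\ y\ge 0\}$, and $\widehat{\mathsf{FQ}\times\mathsf{FQ}}:=\{(\mathbf{u},\mathbf{v})\in\mathsf{FQ}\times\mathsf{FQ}\mid \mathbf{u}\cdot\mathbf{v}=1\}$. The map $\Phi:\widehat{\mathsf{FQ}\times\mathsf{FQ}}\to\mathrm{SL}(2,\mathbb{R})$ is $\Phi\left((a,b)^T,(c,d)^T\right):=\begin{pmatrix}a&b\\-d&c\end{pmatrix}$. The $G_q$-Farey triangle is $\mathcal{T}^q:=\{(a,b)\in\mathbb{R}^2\mid 0<a\le 1,\ 1-\lambda_q a<b\le 1\}$. It is the disjoint union of the sets $\mathcal{T}_i^q:=\{(a,b)\in\mathcal{T}^q\mid (a,b)^T\cdot\mathfrak{w}_{i-1}^q>1,\ (a,b)^T\cdot\mathfrak{w}_i^q\le 1\}$, $i=2,\dots,q-1$, and the roof function $R_q:\mathcal{T}^q\to(0,\infty)$ is given on $\mathcal{T}_i^q$ by $R_q(a,b)=\dfrac{y_i^q}{a\,\left((a,b)^T\cdot\mathfrak{w}_i^q\right)}$. The suspension is $S_{R_q}\mathcal{T}^q:=\{((a,b),s)\mid (a,b)\in\mathcal{T}^q,\ 0\le s<R_q(a,b)\}$, whose point $((a,b),s)$ is identified with the coset $h_sg_{a,b}G_q$. It is known from earlier work that this identification is injective, that its image has full Haar measure in $\mathrm{SL}(2,\mathbb{R})/G_q$, and that $\mathcal{T}^q$ (via $(a,b)\mapsto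 g_{a,b}G_q$) is a cross section to the horocycle flow with first return time $R_q$. "Cross section" to a flow $(\phi_t)_{t\in\mathbb{R}}$ on $X_q=\mathrm{SL}(2,\mathbb{R})/G_q$ is meant in the usual measure-theoretic sense: a subset $\Omega\subset X_q$ such that for almost every $x\in X_q$ with respect to the Haar probability measure, the set of times $\{t\in\mathbb{R}\mid\phi_t(x)\in\Omega\}$ is discrete and unbounded above and below. *)

theory Defs
  imports
    "HOL-Analysis.Analysis"
    "HOL-Probability.Probability_Measure"
    "HOL-Algebra.Coset"
    "HOL-Algebra.Generated_Groups"
begin

text \<open>Matrices have type \<^typ>\<open>real^2^2\<close> and are written as the list of their rows.\<close>

definition SL2R :: "(real^2^2) monoid" where
  "SL2R = \<lparr>carrier = {A. det A = 1}, mult = (**), one = mat 1\<rparr>"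

definition hecke_lambda :: "nat \<Rightarrow> real" where
  "hecke_lambda q = 2 * cos (pi / real q)"

definition hecke_S :: "real^2^2" where
  "hecke_S = vector [vector [0, -1], vector [1, 0]]"

definition hecke_T :: "nat \<Rightarrow> real^2^2" where
  "hecke_T q = vector [vector [1, hecke_lambda q], vector [0, 1]]"

definition hecke_group :: "nat \<Rightarrow> (real^2^2) set" where
  "hecke_group q = generate SL2R {hecke_S, hecke_T q}"

definition hecke_U :: "nat \<Rightarrow> real^2^2" where
  "hecke_U q = hecke_T q ** hecke_S"

definition hecke_w :: "nat \<Rightarrow> nat \<Rightarrow> real^2" where
  "hecke_w q i = ((\<lambda>v. hecke_U q *v v) ^^ i) (vector [1, 0])"

definition h_mat :: "real \<Rightarrow> real^2^2" where
  "h_mat s = vector [vector [1, 0], vector [-s, 1]]"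

definition g_mat :: "real \<Rightarrow> real^2^2" where
  "g_mat t = vector [vector [exp t, 0], vector [0, exp (-t)]]"

text \<open>The matrix \<open>g\<^bsub>a,b\<^esub>\<close>; it is only meaningful for \<open>a > 0\<close>.\<close>

definition g_upper :: "real \<Rightarrow> real \<Rightarrow> real^2^2" where
  "g_upper a b = vector [vector [a, b], vector [0, inverse a]]"

definition coset_of :: "nat \<Rightarrow> real^2^2 \<Rightarrow> (real^2^2) set" where
  "coset_of q g = g <#\<^bsub>SL2R\<^esub> hecke_group q"

definition hecke_space :: "nat \<Rightarrow> (real^2^2) set set" where
  "hecke_space q = coset_of q ` carrier SL2R"

definition horocycle_flow :: "real \<Rightarrow> (real^2^2) set \<Rightarrow> (real^2^2) set" where
  "horocycle_flow s x = h_mat s <#\<^bsub>SL2R\<^esub> x"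

definition geodesic_flow :: "real \<Rightarrow> (real^2^2) set \<Rightarrow> (real^2^2) set" where
  "geodesic_flow t x = g_mat t <#\<^bsub>SL2R\<^esub> x"

text \<open>The Haar probability measure on \<open>SL(2,\<real>)/G\<^sub>q\<close> is characterised as the probability measure
  on the Borel sets of the quotient topology that is invariant under left translation by
  \<open>SL(2,\<real>)\<close>. It exists and is unique because \<open>G\<^sub>q\<close> is a lattice.\<close>

definition quotient_open :: "nat \<Rightarrow> (real^2^2) set set \<Rightarrow> bool" where
  "quotient_open q \<U> \<longleftrightarrow>
     \<U> \<subseteq> hecke_space q \<and>
     openin (top_of_set (carrier SL2R)) {g \<in> carrier SL2R. coset_of q g \<in> \<U>}"

definition is_haar_prob :: "nat \<Rightarrow> (real^2^2) set measure \<Rightarrow> bool" where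
  "is_haar_prob q M \<longleftrightarrow>
     prob_space M \<and>
     space M = hecke_space q \<and>
     sets M = sigma_sets (hecke_space q) {\<U>. quotient_open q \<U>} \<and>
     (\<forall>g \<in> carrier SL2R. \<forall>A \<in> sets M.
        emeasure M ((\<lambda>x. g <#\<^bsub>SL2R\<^esub> x) ` A) = emeasure M A)"

definition cross_section :: "'x measure \<Rightarrow> (real \<Rightarrow> 'x \<Rightarrow> 'x) \<Rightarrow> 'x set \<Rightarrow> bool" where
  "cross_section M \<phi> \<Omega> \<longleftrightarrow>
     \<Omega> \<subseteq> space M \<and>
     (AE x in M. discrete {t. \<phi> t x \<in> \<Omega>} \<and>
                 \<not> bdd_above {t. \<phi> t x \<in> \<Omega>} \<and>
                 \<not> bdd_below {t. \<phi> t x \<in> \<Omega>})"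

definition FQ :: "(real^2) set" where
  "FQ = {u. u $ 1 > 0 \<and> u $ 2 \<ge> 0}"

definition FQFQ :: "((real^2) \<times> (real^2)) set" where
  "FQFQ = {(u, v). u \<in> FQ \<and> v \<in> FQ \<and> u \<bullet> v = 1}"

definition Phi :: "real^2 \<Rightarrow> real^2 \<Rightarrow> real^2^2" where
  "Phi u v = vector [vector [u $ 1, u $ 2], vector [- (v $ 2), v $ 1]]"

definition farey_triangle :: "nat \<Rightarrow> (real^2) set" where
  "farey_triangle q =
     {u. 0 < u $ 1 \<and> u $ 1 \<le> 1 \<and> 1 - hecke_lambda q * u $ 1 < u $ 2 \<and> u $ 2 \<le> 1}"

definition farey_piece :: "nat \<Rightarrow> nat \<Rightarrow> (real^2) set" where
  "farey_piece q i =
     {u \<in> farey_triangle q. u \<bullet> hecke_w q (i - 1) > 1 \<and> u \<bullet> hecke_w q i \<le> 1}"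

text \<open>The pieces with index in \<open>{2..q - 1}\<close> partition the triangle, so that the index below is
  well defined on it.\<close>

definition farey_index :: "nat \<Rightarrow> real^2 \<Rightarrow> nat" where
  "farey_index q u = (THE i. i \<in> {2..q - 1} \<and> u \<in> farey_piece q i)"

definition farey_roof :: "nat \<Rightarrow> real^2 \<Rightarrow> real" where
  "farey_roof q u =
     (let w = hecke_w q (farey_index q u) in w $ 2 / (u $ 1 * (u \<bullet> w)))"

definition farey_suspension :: "nat \<Rightarrow> ((real^2) \<times> real) set" where
  "farey_suspension q =
     {(u, s). u \<in> farey_triangle q \<and> 0 \<le> s \<and> s < farey_roof q u}"

definition suspension_coset :: "nat \<Rightarrow> (real^2) \<times> real \<Rightarrow> (real^2^2) set" where
  "suspension_coset q = (\<lambda>(u, s). coset_of q (h_mat s ** g_upper (u $ 1) (u $ 2)))"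

definition hecke_polygon :: "nat \<Rightarrow> (real^2) set" where
  "hecke_polygon q =
     convex hull (hecke_w q ` {0..q - 1}) - closed_segment (hecke_w q 0) (hecke_w q (q - 1))"

definition SP :: "nat \<Rightarrow> ((real^2) \<times> (real^2)) set" where
  "SP q = {(u, v) \<in> FQFQ. u \<in> hecke_polygon q}"

end

theory Submission
  imports Defs
begin

text \<open>
  The geodesics joining the directions of the two columns of a matrix in \<open>G\<^sub>q\<close> are the sides of a
  tessellation of the hyperbolic plane by ideal \<open>q\<close>-gons. For a coset \<open>gG\<^sub>q\<close>, the geodesic from slope \<open>0\<close> to slope \<open>\<infinity>\<close> crosses a
  chain of sides of the \<open>g\<close>-image of that tessellation; a matrix \<open>\<Phi>(u, v)\<close> records one crossed side,
  and \<open>u\<close> lists the \<open>x\<close>-coordinates of its two end vectors. Along the chain the sum \<open>u\<^sub>1 + u\<^sub>2\<close>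
  decreases strictly, and \<open>u \<in> P\<close> says that this is the last side whose sum exceeds \<open>1\<close>. This gives
  injectivity, once \<open>G\<^sub>q\<close> is written as \<open>\<plusminus>{1, S} M {1, S}\<close> for a monoid \<open>M\<close> of nonnegative matrices.
  A point of the suspension is a pair of consecutive vectors in the strip \<open>0 < x \<le> 1\<close>, with slopes
  \<open>\<le> 0\<close> and \<open>> 0\<close>; both belong to one polygon, and walking around that polygon turns one description
  into the other.

  The return times to the base are the slopes of certain vectors, among them all vectors of the strip,
  and those of the geodesic flow are \<open>- ln (u\<^sub>1 + u\<^sub>2)\<close> over the crossed sides. They are discrete because
  matrix entries of \<open>G\<^sub>q\<close> are \<open>0\<close> or at least \<open>1\<close> in absolute value, and unbounded as soon as no vector
  of the orbit lies on an axis. Cosets with a vector on a given axis form a null set: the diagonal flow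
  rescales the length of that vector, so by invariance infinitely many disjoint sets have equal measure.
\<close>

section \<open>Two-by-two matrices in coordinates\<close>

definition m2 :: "real \<Rightarrow> real \<Rightarrow> real \<Rightarrow> real \<Rightarrow> real^2^2" where
  "m2 a b c d = vector [vector [a, b], vector [c, d]]"

lemma m2_nth [simp]:
  "m2 a b c d $ 1 $ 1 = a" "m2 a b c d $ 1 $ 2 = b"
  "m2 a b c d $ 2 $ 1 = c" "m2 a b c d $ 2 $ 2 = d"
  by (simp_all add: m2_def)

lemma m2_eq_iff: "A = B \<longleftrightarrow> A $ 1 $ 1 = B $ 1 $ 1 \<and> A $ 1 $ 2 = B $ 1 $ 2 \<and>
    A $ 2 $ 1 = B $ 2 $ 1 \<and> A $ 2 $ 2 = B $ 2 $ 2" for A B :: "real^2^2"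
  by (auto simp: vec_eq_iff forall_2)

lemma m2_inject [simp]: "m2 a b c d = m2 a' b' c' d' \<longleftrightarrow> a = a' \<and> b = b' \<and> c = c' \<and> d = d'"
  by (simp add: m2_eq_iff)

lemma m2_collapse: "m2 (A $ 1 $ 1) (A $ 1 $ 2) (A $ 2 $ 1) (A $ 2 $ 2) = A"
  by (simp add: m2_eq_iff)

lemma m2_cases: obtains a b c d where "A = m2 a b c d"
  by (metis m2_collapse)

lemma matrix_mult_2_nth:
  "(A ** B) $ i $ j = A $ i $ 1 * B $ 1 $ j + A $ i $ 2 * B $ 2 $ j" for A B :: "real^2^2"
  by (simp add: matrix_matrix_mult_def sum_2)

lemma m2_mult [simp]: "m2 a b c d ** m2 a' b' c' d' =
    m2 (a * a' + b * c') (a * b' + b * d') (c * a' + d * c') (c * b' + d * d')"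
  by (simp add: m2_eq_iff matrix_mult_2_nth)

lemma m2_uminus [simp]: "- m2 a b c d = m2 (- a) (- b) (- c) (- d)"
  by (simp add: m2_eq_iff)

lemma det_m2 [simp]: "det (m2 a b c d) = a * d - b * c"
  by (simp add: det_2)

lemma mat_1_m2: "mat 1 = m2 1 0 0 1"
  by (simp add: m2_eq_iff mat_def)

lemma m2_mult_vec: "m2 a b c d *v v = vector [a * v $ 1 + b * v $ 2, c * v $ 1 + d * v $ 2]"
  by (simp add: vec_eq_iff forall_2 matrix_vector_mult_def sum_2)

lemma hecke_S_m2: "hecke_S = m2 0 (-1) 1 0"
  by (simp add: hecke_S_def m2_def)

lemma hecke_T_m2: "hecke_T q = m2 1 (hecke_lambda q) 0 1"
  by (simp add: hecke_T_def m2_def)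

lemma h_mat_m2: "h_mat s = m2 1 0 (- s) 1"
  by (simp add: h_mat_def m2_def)

lemma g_mat_m2: "g_mat t = m2 (exp t) 0 0 (exp (- t))"
  by (simp add: g_mat_def m2_def)

lemma g_upper_m2: "g_upper a b = m2 a b 0 (inverse a)"
  by (simp add: g_upper_def m2_def)

lemma Phi_m2: "Phi u v = m2 (u $ 1) (u $ 2) (- (v $ 2)) (v $ 1)"
  by (simp add: Phi_def m2_def)

lemma matrix_minus_mult [simp]: "(- A) ** B = - (A ** B)" "A ** (- B) = - (A ** B)"
  for A B :: "real^2^2"
  by (simp_all add: m2_eq_iff matrix_mult_2_nth)

lemma det_uminus_2 [simp]: "det (- A) = det A" for A :: "real^2^2"
  by (simp add: det_2)

subsection \<open>Groups and cosets\<close>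

lemma SL2R_simps [simp]:
  "A \<in> carrier SL2R \<longleftrightarrow> det A = 1" "A \<otimes>\<^bsub>SL2R\<^esub> B = A ** B" "\<one>\<^bsub>SL2R\<^esub> = mat 1"
  by (simp_all add: SL2R_def)

text \<open>The adjugate, an explicit inverse on determinant 1, so that inverses can be computed
  entrywise.\<close>

definition m2_adj :: "real^2^2 \<Rightarrow> real^2^2" where
  "m2_adj A = m2 (A $ 2 $ 2) (- (A $ 1 $ 2)) (- (A $ 2 $ 1)) (A $ 1 $ 1)"

lemma m2_adj_inverse:
  assumes "det A = 1"
  shows "m2_adj A ** A = mat 1" "A ** m2_adj A = mat 1" "det (m2_adj A) = 1"
  using assms by (simp_all add: m2_adj_def m2_eq_iff matrix_mult_2_nth mat_1_m2 det_2 algebra_simps)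

lemma group_SL2R: "group SL2R"
proof (rule groupI)
  fix A assume "A \<in> carrier SL2R"
  then show "\<exists>B\<in>carrier SL2R. B \<otimes>\<^bsub>SL2R\<^esub> A = \<one>\<^bsub>SL2R\<^esub>"
    using m2_adj_inverse[of A] by auto
qed (auto simp: det_mul matrix_mul_assoc)

lemma SL2R_inv: "det A = 1 \<Longrightarrow> inv\<^bsub>SL2R\<^esub> A = m2_adj A"
  using group.inv_equality[OF group_SL2R, of "m2_adj A" A] m2_adj_inverse[of A] by simp

lemma hecke_group_subgroup: "subgroup (hecke_group q) SL2R"
  unfolding hecke_group_def
  by (rule group.generate_is_subgroup[OF group_SL2R]) (auto simp: hecke_S_m2 hecke_T_m2)

lemma hecke_group_det: "\<gamma> \<in> hecke_group q \<Longrightarrow> det \<gamma> = 1"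
  using subgroup.mem_carrier[OF hecke_group_subgroup] by fastforce

lemma hecke_group_mult: "\<gamma> \<in> hecke_group q \<Longrightarrow> \<delta> \<in> hecke_group q \<Longrightarrow> \<gamma> ** \<delta> \<in> hecke_group q"
  using subgroup.m_closed[OF hecke_group_subgroup] by fastforce

lemma hecke_group_adj: "\<gamma> \<in> hecke_group q \<Longrightarrow> m2_adj \<gamma> \<in> hecke_group q"
  using subgroup.m_inv_closed[OF hecke_group_subgroup] SL2R_inv hecke_group_det by metis

lemma hecke_group_one: "mat 1 \<in> hecke_group q"
  using subgroup.one_closed[OF hecke_group_subgroup] by simp

lemma hecke_group_S: "hecke_S \<in> hecke_group q"
  unfolding hecke_group_def by (rule generate.incl) simp

lemma hecke_group_T: "hecke_T q \<in> hecke_group q"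
  unfolding hecke_group_def by (rule generate.incl) simp

text \<open>The square of \<open>hecke_S\<close> is minus the identity.\<close>

lemma hecke_group_uminus: 
  assumes "\<gamma> \<in> hecke_group q"
  shows "- \<gamma> \<in> hecke_group q"
proof -
  have "- \<gamma> = (hecke_S ** hecke_S) ** \<gamma>"
    by (cases \<gamma> rule: m2_cases) (simp add: hecke_S_m2)
  then show ?thesis
    using assms hecke_group_S hecke_group_mult by metis
qed

lemma coset_of_eq_image: "coset_of q g = (\<lambda>\<gamma>. g ** \<gamma>) ` hecke_group q"
  by (auto simp: coset_of_def l_coset_def)

lemma l_coset_coset_of: "a <#\<^bsub>SL2R\<^esub> coset_of q g = coset_of q (a ** g)"
proof -
  have "a <#\<^bsub>SL2R\<^esub> coset_of q g = (\<lambda>x. a ** x) ` coset_of q g"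
    by (auto simp: l_coset_def)
  then show ?thesis
    by (simp add: coset_of_eq_image image_image matrix_mul_assoc)
qed

lemma coset_of_eq_iff:
  assumes "det g = 1" "det g' = 1"
  shows "coset_of q g = coset_of q g' \<longleftrightarrow> (\<exists>\<gamma>\<in>hecke_group q. g' = g ** \<gamma>)"
proof
  assume "coset_of q g = coset_of q g'"
  moreover have "g' \<in> coset_of q g'"
    unfolding coset_of_eq_image using hecke_group_one[of q] by (metis image_eqI matrix_mul_rid)
  ultimately show "\<exists>\<gamma>\<in>hecke_group q. g' = g ** \<gamma>"
    by (auto simp: coset_of_eq_image)
next
  assume "\<exists>\<gamma>\<in>hecke_group q. g' = g ** \<gamma>"
  then obtain \<gamma> where \<gamma>: "\<gamma> \<in> hecke_group q" "g' = g ** \<gamma>" by blast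
  have "(\<lambda>\<delta>. \<gamma> ** \<delta>) ` hecke_group q = hecke_group q"
  proof safe
    fix \<delta> assume "\<delta> \<in> hecke_group q"
    moreover have "\<delta> = \<gamma> ** (m2_adj \<gamma> ** \<delta>)"
      using m2_adj_inverse hecke_group_det[OF \<gamma>(1)] by (simp add: matrix_mul_assoc)
    ultimately show "\<delta> \<in> (\<lambda>\<delta>. \<gamma> ** \<delta>) ` hecke_group q"
      using hecke_group_mult hecke_group_adj \<gamma>(1) by blast
  qed (simp add: hecke_group_mult \<gamma>(1))
  then show "coset_of q g = coset_of q g'"
    unfolding coset_of_eq_image \<gamma>(2) by (metis (no_types, lifting) image_cong image_image matrix_mul_assoc)
qed

locale hecke =
  fixes q :: nat
  assumes q_ge_3: "3 \<le> q"
begin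

subsection \<open>Chebyshev sequences\<close>

abbreviation lam :: real where "lam \<equiv> hecke_lambda q"

text \<open>The Chebyshev values U_(k-1)(cos(pi/q)), which are the coordinates of the vectors
  \<open>hecke_w q i\<close>. Integer indices let the recurrence run both ways around the
  polygon.\<close>

definition sg :: "int \<Rightarrow> real" where
  "sg k = sin (of_int k * (pi / real q)) / sin (pi / real q)"

lemma angle_bounds: "0 < pi / real q" "pi / real q \<le> pi / 3" "pi / real q < pi / 2" "pi / real q < pi"
proof -
  show 1: "0 < pi / real q" using q_ge_3 by simp
  show 2: "pi / real q \<le> pi / 3" using q_ge_3 by (intro divide_left_mono) auto
  show "pi / real q < pi / 2" "pi / real q < pi"
    using 2 pi_gt_zero by linarith+
qed

lemma sin_angle_pos: "0 < sin (pi / real q)"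
  using angle_bounds by (intro sin_gt_zero) auto

lemma lam_ge_1: "1 \<le> lam"
proof -
  have "cos (pi / 3) \<le> cos (pi / real q)"
    using angle_bounds by (intro cos_monotone_0_pi_le) auto
  then show ?thesis by (simp add: hecke_lambda_def cos_60)
qed

lemma lam_less_2: "lam < 2"
proof -
  have "cos (pi / real q) < cos 0"
    using angle_bounds by (intro cos_monotone_0_pi) auto
  then show ?thesis by (simp add: hecke_lambda_def)
qed

lemma sg_0 [simp]: "sg 0 = 0" and sg_1 [simp]: "sg 1 = 1"
  using sin_angle_pos by (auto simp: sg_def)

lemma sg_minus: "sg (- k) = - sg k"
  by (simp add: sg_def)

lemma sg_rec: "sg (k + 1) = lam * sg k - sg (k - 1)"
proof -
  let ?t = "pi / real q" and ?K = "of_int k * (pi / real q)"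
  have e: "of_int (k + 1) * ?t = ?K + ?t" "of_int (k - 1) * ?t = ?K - ?t"
    by (simp_all add: algebra_simps add_divide_distrib diff_divide_distrib)
  have "sin (?K + ?t) = 2 * cos ?t * sin ?K - sin (?K - ?t)"
    by (simp add: sin_add sin_diff)
  then show ?thesis
    unfolding sg_def e hecke_lambda_def by (simp add: diff_divide_distrib)
qed

lemma sg_2 [simp]: "sg 2 = lam"
  using sg_rec[of 1] by simp

lemma sg_add_q: "sg (k + int q) = - sg k"
proof -
  have "of_int (k + int q) * (pi / q) = of_int k * (pi / q) + pi"
    using q_ge_3 by (simp add: field_simps)
  then show ?thesis by (simp add: sg_def del: of_int_add)
qed

lemma sg_diff_q: "sg (int q - k) = sg k"
  using sg_add_q[of "- k"] by (simp add: sg_minus)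

lemma sg_q [simp]: "sg (int q) = 0"
  using sg_add_q[of 0] by simp

text \<open>On [pi/q, pi - pi/q] the sine is smallest at the ends. This is the source of the gap
  between 0 and 1 in the matrix entries.\<close>

lemma sg_ge_1:
  assumes "0 < k" "k < int q"
  shows "1 \<le> sg k"
proof -
  define x where "x = of_int k * (pi / real q)"
  have "1 * (pi / real q) \<le> x" "x \<le> (real q - 1) * (pi / real q)"
    unfolding x_def using assms angle_bounds by (intro mult_right_mono; simp)+
  moreover have "(real q - 1) * (pi / real q) = pi - pi / real q"
    using q_ge_3 by (simp add: field_simps)
  ultimately have 1: "pi / real q \<le> x" "x \<le> pi - pi / real q"
    by simp_all
  have "sin (pi / real q) \<le> sin x"
  proof (cases "x \<le> pi / 2")
    case True
    then show ?thesis using 1 angle_bounds by (intro sin_monotone_2pi_le) auto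
  next
    case False
    then have "sin (pi / real q) \<le> sin (pi - x)"
      using 1 angle_bounds by (intro sin_monotone_2pi_le) auto
    then show ?thesis by simp
  qed
  then show ?thesis
    using sin_angle_pos by (simp add: sg_def x_def)
qed

lemma sg_pos: "0 < k \<Longrightarrow> k < int q \<Longrightarrow> 0 < sg k"
  using sg_ge_1[of k] by simp

lemma sg_nonneg: "0 \<le> k \<Longrightarrow> k \<le> int q \<Longrightarrow> 0 \<le> sg k"
  using sg_pos[of k] by (cases "k = 0 \<or> k = int q") auto

text \<open>A Wronskian: the determinant of two vertices of the polygon depends only on the
  difference of their indices.\<close>

lemma sg_cross: "sg (j + 1) * sg k - sg j * sg (k + 1) = sg (k - j)"
proof -
  let ?t = "pi / real q" and ?J = "of_int j * (pi / real q)" and ?K = "of_int k * (pi / real q)"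
  have "sin (?J + ?t) * sin ?K - sin ?J * sin (?K + ?t) = sin ?t * (sin ?K * cos ?J - cos ?K * sin ?J)"
    by (simp add: sin_add algebra_simps)
  also have "\<dots> = sin ?t * sin (?K - ?J)"
    by (simp add: sin_diff)
  finally have *: "sin (?J + ?t) * sin ?K - sin ?J * sin (?K + ?t) = sin ?t * sin (?K - ?J)" .
  have e: "of_int (j + 1) * ?t = ?J + ?t" "of_int (k + 1) * ?t = ?K + ?t" "of_int (k - j) * ?t = ?K - ?J"
    by (simp_all add: algebra_simps add_divide_distrib diff_divide_distrib)
  have "sg (j + 1) * sg k - sg j * sg (k + 1)
      = (sin (?J + ?t) * sin ?K - sin ?J * sin (?K + ?t)) / (sin ?t * sin ?t)"
    unfolding sg_def e by (simp add: diff_divide_distrib)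
  also have "\<dots> = sg (k - j)"
    unfolding * sg_def e using sin_angle_pos by simp
  finally show ?thesis .
qed

text \<open>The recurrence preserves the form x^2 + y^2 - \<open>lam\<close> x y; its value 1 is
  \<open>sg_cross\<close> for neighbouring indices.\<close>

lemma sg_energy: "(sg (k + 1))\<^sup>2 + (sg k)\<^sup>2 - lam * sg k * sg (k + 1) = 1"
proof -
  have "sg (k + 1 + 1) = lam * sg (k + 1) - sg k"
    using sg_rec[of "k + 1"] by simp
  from sg_cross[of k "k + 1", unfolded this] show ?thesis
    by (simp add: algebra_simps power2_eq_square)
qed

text \<open>A shift by q flips both signs, so the product may be evaluated at the residue of
  \<open>k\<close> modulo q, where both factors are nonnegative.\<close>

lemma sg_adjacent: "0 \<le> sg k * sg (k + 1)"
proof -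
  have shift: "sg (k + int q * int n) * sg (k + int q * int n + 1) = sg k * sg (k + 1)" for k n
  proof (induction n)
    case (Suc n)
    then show ?case
      using sg_add_q[of "k + int q * int n"] sg_add_q[of "k + int q * int n + 1"]
      by (simp add: algebra_simps)
  qed simp
  have base: "0 \<le> sg k * sg (k + 1)" if "0 \<le> k" "k < int q" for k
    using that by (intro mult_nonneg_nonneg sg_nonneg) auto
  define r where "r = k mod int q"
  have r: "0 \<le> r" "r < int q" using q_ge_3 by (auto simp: r_def)
  have k: "k = r + int q * (k div int q)" by (simp add: r_def)
  show ?thesis
  proof (cases "0 \<le> k div int q")
    case True
    then show ?thesis using shift[of r "nat (k div int q)"] base[OF r] k by simp
  next
    case False
    then have "k + int q * int (nat (- (k div int q))) = r"
      using k by simp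
    then show ?thesis using shift[of k "nat (- (k div int q))"] base[OF r] by simp
  qed
qed

text \<open>By \<open>sg_energy\<close> the square is 1 minus a nonnegative term. Read at the
  vertices, this puts each of them on the inner side of every side line.\<close>

lemma sg_diff_le_1: "\<bar>sg (k + 1) - sg k\<bar> \<le> 1"
proof -
  have "(sg (k + 1) - sg k)\<^sup>2 = 1 - (2 - lam) * (sg k * sg (k + 1))"
    using sg_energy[of k] by (simp add: algebra_simps power2_eq_square)
  also have "\<dots> \<le> 1"
    using sg_adjacent[of k] lam_less_2 by simp
  finally show ?thesis by (simp add: abs_square_le_1)
qed

text \<open>The solution of the recurrence \<open>x\<^bsub>k+1\<^esub> + x\<^bsub>k-1\<^esub> = \<lambda> x\<^sub>k\<close> with \<open>x\<^sub>0 = a\<close> and \<open>x\<^sub>1 = b\<close>.\<close>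

definition rho :: "real \<Rightarrow> real \<Rightarrow> int \<Rightarrow> real" where
  "rho a b k = b * sg k - a * sg (k - 1)"

lemma rho_0 [simp]: "rho a b 0 = a" and rho_1 [simp]: "rho a b 1 = b"
  using sg_minus[of 1] by (simp_all add: rho_def)

lemma rho_rec: "rho a b (k + 1) = lam * rho a b k - rho a b (k - 1)"
proof -
  have 2: "sg (k - 1 - 1) = lam * sg (k - 1) - sg k"
    using sg_rec[of "k - 1"] by simp
  show ?thesis
    unfolding rho_def add_diff_cancel_right' sg_rec[of k] 2 by (simp add: algebra_simps)
qed

lemma rho_add_q: "rho a b (k + int q) = - rho a b k"
  using sg_add_q[of k] sg_add_q[of "k - 1"] by (simp add: rho_def algebra_simps)

lemma rho_cross: "rho a b j * rho c d k - rho c d j * rho a b k = (a * d - b * c) * sg (k - j)"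
proof -
  have "rho a b j * rho c d k - rho c d j * rho a b k
     = (a * d - b * c) * (sg j * sg (k - 1) - sg (j - 1) * sg k)"
    by (simp add: rho_def algebra_simps)
  then show ?thesis using sg_cross[of "j - 1" "k - 1"] by (simp add: algebra_simps)
qed

lemma rho_rho: "rho (rho a b j) (rho a b (j + 1)) k = rho a b (j + k)"
proof -
  \<comment> \<open>The addition formula, which is \<open>sg_cross\<close> with a negated
    index.\<close>
  have "sg (j + k) = sg (j + 1) * sg k - sg j * sg (k - 1)" for j k
    using sg_cross[of "- k" j] sg_minus[of "k - 1"] by (simp add: sg_minus algebra_simps)
  from this[of j k] this[of "j - 1" k]
  have 1: "sg (j + k) = sg (j + 1) * sg k - sg j * sg (k - 1)"
    and 2: "sg (j + k - 1) = sg j * sg k - sg (j - 1) * sg (k - 1)"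
    by (simp_all add: algebra_simps)
  show ?thesis
    unfolding rho_def add_diff_cancel_right' 1 2 by (simp add: algebra_simps)
qed


subsection \<open>The positive monoid\<close>

text \<open>For \<open>0 < j < q\<close> the columns of \<open>W j\<close> are \<open>w\<^bsub>j-1\<^esub>\<close> and \<open>w\<^sub>j\<close>, a side of the ideal \<open>q\<close>-gon.\<close>

definition W :: "int \<Rightarrow> real^2^2" where
  "W j = m2 (sg j) (sg (j + 1)) (sg (j - 1)) (sg j)"

lemma W_0: "W 0 = - hecke_S" and W_1: "W 1 = hecke_T q" and W_q: "W (int q) = hecke_S"
  and W_q_minus_1: "W (int q - 1) = m2 1 0 lam 1"
  using sg_minus[of 1] sg_add_q[of 1] sg_diff_q[of 1] sg_diff_q[of 2]
  by (simp_all add: W_def hecke_S_m2 hecke_T_m2 add.commute)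

text \<open>Left multiplication by \<open>hecke_U q\<close> rotates the polygon and moves each side
  to the next.\<close>

lemma TS_W: "hecke_T q ** hecke_S ** W j = W (j + 1)"
proof -
  have "sg (j + 1 + 1) = lam * sg (j + 1) - sg j"
    using sg_rec[of "j + 1"] by simp
  then show ?thesis
    using sg_rec[of j] by (simp add: W_def hecke_S_m2 hecke_T_m2)
qed

text \<open>The inverse of T is S U^(-1), and U^(-1) rotates the polygon backwards.\<close>

lemma T_inv_W: "m2_adj (hecke_T q) ** W j = hecke_S ** W (j - 1)"
proof -
  have "sg (j - 1 - 1) = lam * sg (j - 1) - sg j"
    using sg_rec[of "j - 1"] by simp
  then show ?thesis
    using sg_rec[of j] by (simp add: W_def hecke_S_m2 hecke_T_m2 m2_adj_def)
qed

lemma T_inv_S: "m2_adj (hecke_T q) ** hecke_S = hecke_S ** W (int q - 1)"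
  by (simp add: W_q_minus_1 hecke_S_m2 hecke_T_m2 m2_adj_def)

lemma S_S: "hecke_S ** hecke_S = - mat 1"
  by (simp add: hecke_S_m2 mat_1_m2)

lemma det_W: "det (W j) = 1"
  using sg_cross[of "j - 1" j] by (simp add: W_def mult.commute)

lemma W_in_group: "0 \<le> j \<Longrightarrow> W j \<in> hecke_group q"
proof (induction j rule: int_ge_induct)
  case base
  then show ?case by (simp add: W_0 hecke_group_S hecke_group_uminus)
next
  case (step j)
  then show ?case
    using hecke_group_S hecke_group_T hecke_group_mult by (metis TS_W)
qed

text \<open>The indices 0 and q are left out because \<open>W\<close> degenerates there to minus and
  plus \<open>hecke_S\<close>; the remaining generators have nonnegative entries.\<close>

inductive_set Mon :: "(real^2^2) set" where
  one: "mat 1 \<in> Mon"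
| step: "0 < j \<Longrightarrow> j < int q \<Longrightarrow> A \<in> Mon \<Longrightarrow> W j ** A \<in> Mon"

lemma Mon_mult: "A \<in> Mon \<Longrightarrow> B \<in> Mon \<Longrightarrow> A ** B \<in> Mon"
  by (induction rule: Mon.induct) (auto simp: matrix_mul_assoc[symmetric] intro: Mon.intros)

lemma Mon_W: "0 < j \<Longrightarrow> j < int q \<Longrightarrow> W j \<in> Mon"
  using Mon.step[OF _ _ Mon.one] by simp

text \<open>The row arguments follow \<open>X ** B ** W j\<close> from the left, so they need the
  last factor rather than the first.\<close>

lemma Mon_right_cases:
  assumes "A \<in> Mon"
  obtains "A = mat 1" | j B where "0 < j" "j < int q" "B \<in> Mon" "A = B ** W j"
proof -
  from assms have "A = mat 1 \<or> (\<exists>j B. 0 < j \<and> j < int q \<and> B \<in> Mon \<and> A = B ** W j)"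
  proof (induction rule: Mon.induct)
    case (step j A)
    from step.IH show ?case
    proof (elim disjE exE conjE)
      assume "A = mat 1"
      then have "W j ** A = mat 1 ** W j" by simp
      then show ?thesis using step.hyps Mon.one by blast
    next
      fix k B assume "0 < k" "k < int q" "B \<in> Mon" "A = B ** W k"
      then have "W j ** A = (W j ** B) ** W k" "W j ** B \<in> Mon"
        using step.hyps by (auto simp: matrix_mul_assoc intro: Mon.step)
      then show ?thesis using \<open>0 < k\<close> \<open>k < int q\<close> by blast
    qed
  qed simp
  then show thesis using that by blast
qed

lemma Mon_det: "A \<in> Mon \<Longrightarrow> det A = 1"
  by (induction rule: Mon.induct) (auto simp: det_mul det_W)

text \<open>Transposition reverses products and turns \<open>W j\<close> into
  \<open>W (int q - j)\<close>.\<close>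

lemma Mon_transpose: "A \<in> Mon \<Longrightarrow> transpose A \<in> Mon"
proof (induction rule: Mon.induct)
  case (step j A)
  have "transpose (W j) = W (int q - j)"
    using sg_diff_q[of j] sg_diff_q[of "j + 1"] sg_diff_q[of "j - 1"]
    by (simp add: m2_eq_iff W_def transpose_def algebra_simps)
  moreover have "W (int q - j) \<in> Mon"
    using step by (intro Mon_W) auto
  ultimately show ?case
    using step Mon_mult by (simp add: matrix_transpose_mul)
qed (simp add: Mon.one transpose_mat)

text \<open>The set of 0 and all reals from 1 on is closed under sums and products and contains the
  entries of the generators.\<close>

lemma Mon_entries: "A \<in> Mon \<Longrightarrow> A $ i $ j = 0 \<or> 1 \<le> A $ i $ j"
proof (induction arbitrary: i j rule: Mon.induct)
  case one
  then show ?case by (simp add: mat_def)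
next
  case (step k A)
  have sg01: "sg k = 0 \<or> 1 \<le> sg k" if "0 \<le> k" "k \<le> int q" for k
    using that sg_ge_1[of k] by (cases "k = 0 \<or> k = int q") auto
  have Wkk: "W k $ i $ j = 0 \<or> 1 \<le> W k $ i $ j" for i j
    using sg01[of k] sg01[of "k + 1"] sg01[of "k - 1"] step.hyps
    using exhaust_2[of i] exhaust_2[of j] by (auto simp: W_def)
  have m: "x * y = 0 \<or> 1 \<le> x * y" if "x = 0 \<or> 1 \<le> x" "y = 0 \<or> 1 \<le> y" for x y :: real
    using that mult_mono[of 1 x 1 y] by auto
  have s: "x + y = 0 \<or> 1 \<le> x + y" if "x = 0 \<or> 1 \<le> x" "y = 0 \<or> 1 \<le> y" for x y :: real
    using that by auto
  show ?case
    unfolding matrix_mult_2_nth by (intro s m Wkk step.IH)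
qed

lemma Mon_nonneg: "A \<in> Mon \<Longrightarrow> 0 \<le> A $ i $ j"
  using Mon_entries[of A i j] by auto

section \<open>Normal form of the group elements\<close>

definition nform :: "(real^2^2) set" where
  "nform = {\<gamma>. \<exists>A\<in>Mon. \<exists>L\<in>{mat 1, hecke_S}. \<exists>R\<in>{mat 1, hecke_S}. \<gamma> = L ** A ** R \<or> \<gamma> = - (L ** A ** R)}"

lemma nform_uminus: "- \<gamma> \<in> nform \<longleftrightarrow> \<gamma> \<in> nform"
proof -
  have "- \<gamma> \<in> nform" if "\<gamma> \<in> nform" for \<gamma>
    using that unfolding nform_def by force
  from this[of \<gamma>] this[of "- \<gamma>"] show ?thesis by auto
qed

lemma nformI:
  assumes "A \<in> Mon" "R \<in> {mat 1, hecke_S}"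
  shows "A ** R \<in> nform" "hecke_S ** (A ** R) \<in> nform"
proof -
  have "mat 1 ** A ** R \<in> nform" "hecke_S ** A ** R \<in> nform"
    using assms unfolding nform_def by blast+
  then show "A ** R \<in> nform" "hecke_S ** (A ** R) \<in> nform"
    by (simp_all add: matrix_mul_assoc)
qed

lemma nform_cases:
  assumes "\<gamma> \<in> nform"
  obtains A R \<delta> where "A \<in> Mon" "R \<in> {mat 1, hecke_S}" "\<delta> = A ** R \<or> \<delta> = hecke_S ** (A ** R)"
    "\<gamma> = \<delta> \<or> \<gamma> = - \<delta>"
proof -
  from assms obtain A L R where *: "A \<in> Mon" "L \<in> {mat 1, hecke_S}" "R \<in> {mat 1, hecke_S}"
     "\<gamma> = L ** A ** R \<or> \<gamma> = - (L ** A ** R)"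
    unfolding nform_def by blast
  have "L ** A ** R = A ** R \<or> L ** A ** R = hecke_S ** (A ** R)"
    using *(2) by (auto simp: matrix_mul_assoc)
  then show thesis
    using that[OF *(1) *(3) _ *(4)] by blast
qed

text \<open>Normal forms will be shown closed under left multiplication by S, T and the inverse of
  T. Signs can be pulled out, so only words beginning with a monoid element or with S
  matter.\<close>

lemma nform_mult_lift:
  assumes "\<And>A R. A \<in> Mon \<Longrightarrow> R \<in> {mat 1, hecke_S} \<Longrightarrow> h ** (A ** R) \<in> nform"
    and "\<And>A R. A \<in> Mon \<Longrightarrow> R \<in> {mat 1, hecke_S} \<Longrightarrow> h ** (hecke_S ** (A ** R)) \<in> nform"
    and "\<gamma> \<in> nform"
  shows "h ** \<gamma> \<in> nform"
  using assms(3)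
proof (cases rule: nform_cases)
  case (1 A R \<delta>)
  have "h ** \<delta> \<in> nform"
    using 1(3) assms(1)[OF 1(1,2)] assms(2)[OF 1(1,2)] by auto
  then show ?thesis
    using 1(4) nform_uminus[of "h ** \<delta>"] by auto
qed

lemma S_nform: "\<gamma> \<in> nform \<Longrightarrow> hecke_S ** \<gamma> \<in> nform"
proof (rule nform_mult_lift)
  fix A R assume *: "A \<in> Mon" "R \<in> {mat 1, hecke_S}"
  show "hecke_S ** (A ** R) \<in> nform" by (rule nformI[OF *])
  have "hecke_S ** (hecke_S ** (A ** R)) = - (A ** R)"
    by (simp add: matrix_mul_assoc S_S)
  then show "hecke_S ** (hecke_S ** (A ** R)) \<in> nform"
    using nformI[OF *] nform_uminus by simp
qed

text \<open>T S \<open>W j\<close> is \<open>W (j + 1)\<close>: a generator again, or S when j + 1 =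
  q.\<close>

lemma T_nform: "\<gamma> \<in> nform \<Longrightarrow> hecke_T q ** \<gamma> \<in> nform"
proof (rule nform_mult_lift)
  fix A R assume A: "A \<in> Mon" and R: "R \<in> {mat 1, hecke_S}"
  have W1: "W 1 ** A \<in> Mon" "W 1 \<in> Mon"
    using A q_ge_3 by (auto intro: Mon.step Mon_W)
  show "hecke_T q ** (A ** R) \<in> nform"
    using nformI(1)[OF W1(1) R] by (simp add: W_1 matrix_mul_assoc)
  from A show "hecke_T q ** (hecke_S ** (A ** R)) \<in> nform"
  proof cases
    case one
    have "W 1 ** hecke_S \<in> nform" "W 1 ** mat 1 \<in> nform"
      using W1(2) by (intro nformI; simp)+
    moreover have "hecke_T q ** (hecke_S ** hecke_S) = - (W 1 ** mat 1)"
      by (simp add: S_S W_1)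
    ultimately show ?thesis
      using R one by (auto simp: W_1 nform_uminus)
  next
    case (step j B)
    have eq: "hecke_T q ** (hecke_S ** (A ** R)) = (W (j + 1) ** B) ** R"
      unfolding step TS_W[symmetric] by (simp add: matrix_mul_assoc)
    show ?thesis
    proof (cases "j + 1 = int q")
      case True
      then show ?thesis
        unfolding eq True W_q using nformI(2)[OF \<open>B \<in> Mon\<close> R] by (simp add: matrix_mul_assoc)
    next
      case False
      then have "W (j + 1) ** B \<in> Mon" using step by (auto intro: Mon.step)
      then show ?thesis unfolding eq using R by (rule nformI)
    qed
  qed
qed

text \<open>The mirror image: T^(-1) \<open>W j\<close> is S \<open>W (j - 1)\<close>, and for j = 1
  the factors S and -S cancel.\<close>

lemma T_inv_nform: "\<gamma> \<in> nform \<Longrightarrow> m2_adj (hecke_T q) ** \<gamma> \<in> nform"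
proof (rule nform_mult_lift)
  fix A R assume A: "A \<in> Mon" and R: "R \<in> {mat 1, hecke_S}"
  have Wq: "W (int q - 1) ** A \<in> Mon" "W (int q - 1) \<in> Mon"
    using A q_ge_3 by (auto intro: Mon.step Mon_W)
  have "m2_adj (hecke_T q) ** (hecke_S ** (A ** R)) = hecke_S ** ((W (int q - 1) ** A) ** R)"
    by (simp add: T_inv_S matrix_mul_assoc)
  then show "m2_adj (hecke_T q) ** (hecke_S ** (A ** R)) \<in> nform"
    using nformI(2)[OF Wq(1) R] by simp
  from A show "m2_adj (hecke_T q) ** (A ** R) \<in> nform"
  proof cases
    case one
    \<comment> \<open>Obtained from \<open>T_inv_S\<close> by multiplying with S on the
      right.\<close>
    have "m2_adj (hecke_T q) = - (hecke_S ** (W (int q - 1) ** hecke_S))"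
      by (simp add: matrix_mul_assoc T_inv_S[symmetric]) (simp add: matrix_mul_assoc[symmetric] S_S)
    moreover have "m2_adj (hecke_T q) ** hecke_S = hecke_S ** (W (int q - 1) ** mat 1)"
      by (simp add: T_inv_S)
    ultimately show ?thesis
      using R one nformI(2)[OF Wq(2), of "mat 1"] nformI(2)[OF Wq(2), of hecke_S] nform_uminus
      by (metis insertE matrix_mul_lid matrix_mul_rid singletonD insertI1 insertCI)
  next
    case (step j B)
    have eq: "m2_adj (hecke_T q) ** (A ** R) = hecke_S ** ((W (j - 1) ** B) ** R)"
      using T_inv_W[of j] unfolding step by (simp add: matrix_mul_assoc)
    show ?thesis
    proof (cases "j = 1")
      case True
      have "hecke_S ** ((W (j - 1) ** B) ** R) = B ** R"
        by (simp add: True W_0) (simp add: matrix_mul_assoc S_S)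
      then show ?thesis
        unfolding eq using nformI(1)[OF \<open>B \<in> Mon\<close> R] by simp
    next
      case False
      then have "W (j - 1) ** B \<in> Mon" using step by (auto intro: Mon.step)
      then show ?thesis unfolding eq using R by (rule nformI)
    qed
  qed
qed

lemma hecke_group_nform: "\<gamma> \<in> hecke_group q \<Longrightarrow> \<gamma> \<in> nform"
proof -
  have "\<forall>\<delta>\<in>nform. \<gamma> ** \<delta> \<in> nform" if "\<gamma> \<in> generate SL2R {hecke_S, hecke_T q}" for \<gamma>
    using that
  proof (induction rule: generate.induct)
    case (inv h)
    have "m2_adj hecke_S = - hecke_S" by (simp add: m2_adj_def hecke_S_m2)
    moreover have "det hecke_S = 1" "det (hecke_T q) = 1" by (simp_all add: hecke_S_m2 hecke_T_m2)
    ultimately show ?case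
      using inv S_nform T_inv_nform by (auto simp: SL2R_inv nform_uminus)
  qed (auto simp: S_nform T_nform matrix_mul_assoc[symmetric])
  moreover assume "\<gamma> \<in> hecke_group q"
  moreover have "mat 1 ** mat 1 \<in> nform"
    by (intro nformI Mon.one) simp
  ultimately have "\<gamma> ** (mat 1 ** mat 1) \<in> nform"
    unfolding hecke_group_def by blast
  then show ?thesis by simp
qed

text \<open>Multiplication by S only permutes and negates entries, so the gap of
  \<open>Mon_entries\<close> survives. This is a quantitative form of discreteness.\<close>

lemma hecke_group_entries:
  assumes "\<gamma> \<in> hecke_group q"
  shows "\<gamma> $ i $ j = 0 \<or> 1 \<le> \<bar>\<gamma> $ i $ j\<bar>"
  using hecke_group_nform[OF assms]
proof (cases rule: nform_cases)
  case (1 A R \<delta>)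
  have S: "(X ** hecke_S) $ i $ j \<in> {X $ i $ 2, - X $ i $ 1}"
    "(hecke_S ** X) $ i $ j \<in> {- X $ 2 $ j, X $ 1 $ j}" for X i j
    using exhaust_2[of i] exhaust_2[of j] by (auto simp: matrix_mult_2_nth hecke_S_m2)
  define P where "P X \<longleftrightarrow> (\<forall>i j. X $ i $ j = 0 \<or> 1 \<le> \<bar>X $ i $ j\<bar>)" for X :: "real^2^2"
  have "P A" unfolding P_def
    using Mon_entries[OF 1(1)] by (metis abs_of_nonneg abs_one order_trans zero_le_one)
  moreover have "P (X ** hecke_S)" "P (hecke_S ** X)" if "P X" for X
    unfolding P_def using that S[of X] unfolding P_def
    by (metis abs_minus_cancel insertE neg_equal_0_iff_equal singletonD)+
  ultimately have "P \<delta>"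
    using 1(2,3) by auto
  then have "\<delta> $ i $ j = 0 \<or> 1 \<le> \<bar>\<delta> $ i $ j\<bar>" by (simp add: P_def)
  then show ?thesis using 1(4) by auto
qed

text \<open>The columns of a crossing matrix are the endpoints of a side of the tessellation by
  \<open>G\<^sub>q\<close>-images of the ideal \<open>q\<close>-gon that is crossed by the geodesic from slope \<open>0\<close> to slope \<open>\<infinity>\<close>.\<close>

definition crossing :: "real^2^2 \<Rightarrow> bool" where
  "crossing X \<longleftrightarrow> 0 < X $ 1 $ 1 \<and> 0 < X $ 1 $ 2 \<and> X $ 2 $ 1 \<le> 0 \<and> 0 < X $ 2 $ 2"

text \<open>Two sides crossed by the same geodesic are comparable along the chain. Signs exclude
  every normal form except A and -SAS, and the latter is the inverse of the transpose of A.\<close>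

lemma crossing_related:
  assumes "crossing X" "crossing (X ** \<gamma>)" "\<gamma> \<in> hecke_group q"
  obtains "\<gamma> \<in> Mon" | A where "A \<in> Mon" "X = X ** \<gamma> ** A"
proof -
  obtain a b c d where X: "X = m2 a b c d" by (rule m2_cases)
  have X': "0 < a" "0 < b" "c \<le> 0" "0 < d"
    using assms(1) by (auto simp: crossing_def X)
  from hecke_group_nform[OF assms(3)] obtain A R \<delta> where *: "A \<in> Mon" "R \<in> {mat 1, hecke_S}"
    "\<delta> = A ** R \<or> \<delta> = hecke_S ** (A ** R)" "\<gamma> = \<delta> \<or> \<gamma> = - \<delta>"
    by (rule nform_cases)
  obtain p r s t where A: "A = m2 p r s t" by (rule m2_cases)
  have nn: "0 \<le> p" "0 \<le> r" "0 \<le> s" "0 \<le> t"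
    using Mon_nonneg[OF *(1), of 1 1] Mon_nonneg[OF *(1), of 1 2] Mon_nonneg[OF *(1), of 2 1]
      Mon_nonneg[OF *(1), of 2 2] by (auto simp: A)
  have det: "p * t - r * s = 1" using Mon_det[OF *(1)] by (simp add: A)
  have rs: "0 \<le> r * s" using nn by simp
  have p: "0 < p" using det nn rs by (cases "p = 0") auto
  have prods: "0 \<le> a * p" "0 \<le> a * r" "0 \<le> b * s" "0 \<le> b * t" 
     "0 < d * p" "0 \<le> d * r" "c * s \<le> 0" "c * t \<le> 0"
    using X' nn p by (auto intro: mult_nonpos_nonneg)
  have cr: "crossing (X ** \<delta>) \<or> crossing (- (X ** \<delta>))"
    using assms(2) *(4) by auto
  show thesis
  proof (cases "R = mat 1")
    case R: True
    show thesis
    proof (cases "\<delta> = A ** R")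
      case True
      have "\<not> crossing (- (X ** \<delta>))"
        using prods by (simp add: crossing_def True R X A)
      then have "\<gamma> = A" using True R *(4) assms(2) by auto
      then show thesis using that(1) *(1) by simp
    next
      case False
      then have "\<delta> = hecke_S ** A" using *(3) R by simp
      \<comment> \<open>The second row of X S A is nonnegative with positive first entry, which
        neither sign allows.\<close>
      then show thesis
        using cr prods by (auto simp: crossing_def X A hecke_S_m2)
    qed
  next
    case False
    then have R: "R = hecke_S" using *(2) by simp
    show thesis
    proof (cases "\<delta> = A ** R")
      case True
      \<comment> \<open>The first row of X A S has one entry \<ge> 0 and one \<le> 0, so neither
        sign makes it positive.\<close>
      then show thesis
        using cr prods by (auto simp: crossing_def X A R hecke_S_m2)
    next
      case False
      then have \<delta>: "\<delta> = m2 (- t) s r (- p)" 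
        using *(3) by (simp add: R A hecke_S_m2)
      have "\<not> crossing (X ** \<delta>)"
        using prods by (auto simp: crossing_def X \<delta>)
      then have "\<gamma> = - \<delta>" using *(4) assms(2) by auto
      moreover have "- \<delta> ** transpose A = mat 1"
        using det unfolding A m2_eq_iff by (simp add: matrix_mult_2_nth \<delta> transpose_def mat_1_m2 algebra_simps)
      ultimately have "\<gamma> ** transpose A = mat 1"
        by simp
      then have "X ** \<gamma> ** transpose A = X"
        by (simp add: matrix_mul_assoc[symmetric])
      from that(2)[OF Mon_transpose[OF *(1)] this[symmetric]] show thesis .
    qed
  qed
qed

section \<open>Growth of row sums and uniqueness of the polygon side\<close>

definition rowsum :: "real^2^2 \<Rightarrow> real" where
  "rowsum X = X $ 1 $ 1 + X $ 1 $ 2"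

lemma mult_W_row:
  "(X ** W j) $ 1 $ 1 = rho (- X $ 1 $ 2) (X $ 1 $ 1) j"
  "(X ** W j) $ 1 $ 2 = rho (- X $ 1 $ 2) (X $ 1 $ 1) (j + 1)" for X :: "real^2^2"
  by (simp_all add: matrix_mult_2_nth W_def rho_def)

text \<open>The coefficient \<open>sg j\<close> is at least 1, and since q \<ge> 3 so is one of
  \<open>sg (j - 1)\<close>, \<open>sg (j + 1)\<close>; the latter supplies the extra entry.\<close>

lemma rowsum_W:
  fixes X :: "real^2^2"
  assumes "0 < j" "j < int q" "0 < X $ 1 $ 1" "0 < X $ 1 $ 2"
  shows "0 < (X ** W j) $ 1 $ 1" "0 < (X ** W j) $ 1 $ 2"
    "rowsum X + min (X $ 1 $ 1) (X $ 1 $ 2) \<le> rowsum (X ** W j)"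
proof -
  define a b where ab: "a = X $ 1 $ 1" "b = X $ 1 $ 2"
  have a: "0 < a" "0 < b" using assms ab by auto
  have s: "1 \<le> sg j" "0 \<le> sg (j - 1)" "0 \<le> sg (j + 1)"
    using assms by (auto intro: sg_ge_1 sg_nonneg)
  have 1: "a * 1 \<le> a * sg j" "b * 1 \<le> b * sg j" "0 \<le> a * sg (j + 1)" "0 \<le> b * sg (j - 1)"
    using s a by (auto intro: mult_left_mono)
  have 2: "a * 1 \<le> a * sg (j + 1) \<or> b * 1 \<le> b * sg (j - 1)"
  proof (cases "j + 1 < int q")
    case True
    then have "1 \<le> sg (j + 1)" using assms by (intro sg_ge_1) auto
    then show ?thesis using a by (auto intro: mult_left_mono)
  next
    case False
    then have "1 \<le> sg (j - 1)" using assms q_ge_3 by (intro sg_ge_1) auto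
    then show ?thesis using a by (auto intro: mult_left_mono)
  qed
  have e: "(X ** W j) $ 1 $ 1 = a * sg j + b * sg (j - 1)" "(X ** W j) $ 1 $ 2 = a * sg (j + 1) + b * sg j"
    by (simp_all add: matrix_mult_2_nth W_def ab)
  show "0 < (X ** W j) $ 1 $ 1" "0 < (X ** W j) $ 1 $ 2"
    unfolding e using 1 a by linarith+
  show "rowsum X + min (X $ 1 $ 1) (X $ 1 $ 2) \<le> rowsum (X ** W j)"
    unfolding rowsum_def e ab[symmetric] using 1 2 a by linarith
qed

lemma rowsum_Mon:
  fixes X :: "real^2^2"
  assumes "A \<in> Mon" "0 < X $ 1 $ 1" "0 < X $ 1 $ 2"
  shows "0 < (X ** A) $ 1 $ 1 \<and> 0 < (X ** A) $ 1 $ 2 \<and> rowsum X \<le> rowsum (X ** A)"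
  using assms
proof (induction arbitrary: X rule: Mon.induct)
  case (step j A)
  have "rowsum X \<le> rowsum (X ** W j)"
    using rowsum_W[OF step.hyps(1,2) step.prems] step.prems by linarith
  then show ?case
    using step.IH[OF rowsum_W(1,2)[OF step.hyps(1,2) step.prems]] by (auto simp: matrix_mul_assoc)
qed simp

text \<open>The defining inequalities of the polygon: \<open>rho a b k - rho a b (k + 1) \<le> 1\<close> says that \<open>(a, b)\<close> lies
  on the origin's side of the line through \<open>w\<^bsub>k-1\<^esub>\<close> and \<open>w\<^sub>k\<close>.\<close>

definition poly_row :: "real \<Rightarrow> real \<Rightarrow> bool" where
  "poly_row a b \<longleftrightarrow> 0 < a \<and> 0 < b \<and> 1 < a + b \<and>
     (\<forall>k. 0 < k \<and> k < int q \<longrightarrow> rho a b k - rho a b (k + 1) \<le> 1)"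

text \<open>At k = q - j the side inequality for \<open>X ** W j\<close> concerns the side by which
  the chain entered this polygon; antiperiodicity of \<open>rho\<close> turns it into a bound on the
  row sum of \<open>X\<close>.\<close>

lemma poly_row_W:
  fixes X :: "real^2^2"
  assumes "0 < j" "j < int q" "poly_row ((X ** W j) $ 1 $ 1) ((X ** W j) $ 1 $ 2)"
  shows "rowsum X \<le> 1"
proof -
  define a b where ab: "a = X $ 1 $ 1" "b = X $ 1 $ 2"
  have "rho (rho (- b) a j) (rho (- b) a (j + 1)) (int q - j) -
      rho (rho (- b) a j) (rho (- b) a (j + 1)) (int q - j + 1) \<le> 1"
    using assms unfolding poly_row_def mult_W_row ab by auto
  then have "rho (- b) a (int q) - rho (- b) a (int q + 1) \<le> 1"
    unfolding rho_rho by (simp add: algebra_simps)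
  then show ?thesis
    using rho_add_q[of "- b" a 0] rho_add_q[of "- b" a 1] by (simp add: rowsum_def ab add.commute)
qed

text \<open>If \<open>A\<close> had a last factor \<open>W j\<close>, the row sum just before it
  would be at most 1 by \<open>poly_row_W\<close> and above 1 by monotonicity.\<close>

lemma poly_row_Mon:
  fixes X :: "real^2^2"
  assumes "A \<in> Mon" "poly_row (X $ 1 $ 1) (X $ 1 $ 2)" "poly_row ((X ** A) $ 1 $ 1) ((X ** A) $ 1 $ 2)"
  shows "A = mat 1"
  using assms(1)
proof (cases rule: Mon_right_cases)
  case (2 j B)
  then have "rowsum (X ** B) \<le> 1"
    using poly_row_W[of j "X ** B"] assms(3) by (simp add: matrix_mul_assoc)
  moreover have "rowsum X \<le> rowsum (X ** B)" "1 < rowsum X"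
    using rowsum_Mon[OF 2(3), of X] assms(2) by (auto simp: poly_row_def rowsum_def)
  ultimately show ?thesis by simp
qed

lemma poly_row_unique:
  assumes "crossing X" "crossing (X ** \<gamma>)" "\<gamma> \<in> hecke_group q"
    "poly_row (X $ 1 $ 1) (X $ 1 $ 2)" "poly_row ((X ** \<gamma>) $ 1 $ 1) ((X ** \<gamma>) $ 1 $ 2)"
  shows "X ** \<gamma> = X"
  using assms(1-3)
proof (cases rule: crossing_related)
  case 1
  have "\<gamma> = mat 1" by (rule poly_row_Mon[OF 1 assms(4,5)])
  then show ?thesis by simp
next
  case (2 A)
  have "A = mat 1"
    by (rule poly_row_Mon[OF 2(1) assms(5)]) (unfold 2(2)[symmetric], rule assms(4))
  then show ?thesis using 2(2)[symmetric] by simp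
qed

end

section \<open>Discrete intermediate value principles\<close>

lemma int_first_failure:
  fixes a b :: int
  assumes "P a" "\<not> P b" "a \<le> b"
  obtains k where "a \<le> k" "k < b" "\<And>m. a \<le> m \<Longrightarrow> m \<le> k \<Longrightarrow> P m" "\<not> P (k + 1)"
proof -
  define n where "n = (LEAST n. \<not> P (a + int n))"
  have "\<not> P (a + int (nat (b - a)))" using assms by simp
  then have n: "\<not> P (a + int n)" "n \<le> nat (b - a)"
    unfolding n_def by (rule LeastI, rule Least_le)
  have "n \<noteq> 0" using n(1) assms(1) by (cases n) auto
  moreover have "P m" if "a \<le> m" "m \<le> a + int n - 1" for m
  proof -
    have "nat (m - a) < n" using that \<open>n \<noteq> 0\<close> by linarith
    then have "P (a + int (nat (m - a)))"
      using not_less_Least[of "nat (m - a)" "\<lambda>n. \<not> P (a + int n)"] by (simp add: n_def)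
    then show ?thesis using that(1) by simp
  qed
  ultimately show thesis
    using n assms(3) by (intro that[of "a + int n - 1"]) auto
qed

lemma int_switch:
  fixes a b :: int
  assumes "P a" "\<not> P b" "a \<le> b"
  shows "\<exists>k. a \<le> k \<and> k < b \<and> P k \<and> \<not> P (k + 1)"
  by (rule int_first_failure[of P, OF assms]) blast

lemma int_last_failure:
  fixes a b :: int
  assumes "P b" "\<not> P a" "a \<le> b"
  obtains k where "a < k" "k \<le> b" "\<And>m. k \<le> m \<Longrightarrow> m \<le> b \<Longrightarrow> P m" "\<not> P (k - 1)"
proof (rule int_first_failure[of "\<lambda>m. P (- m)" "- b" "- a"])
  fix k assume k: "- b \<le> k" "k < - a" "\<And>m. - b \<le> m \<Longrightarrow> m \<le> k \<Longrightarrow> P (- m)" "\<not> P (- (k + 1))"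
  show thesis
  proof (rule that[of "- k"])
    show "P m" if "- k \<le> m" "m \<le> b" for m
      using k(3)[of "- m"] that by simp
    show "\<not> P (- k - 1)" using k(4) by simp
  qed (use k in auto)
qed (use assms in auto)

context hecke
begin

subsection \<open>The polygon\<close>

lemma hecke_w_eq: "hecke_w q n = vector [sg (int n + 1), sg (int n)]"
proof (induction n)
  case (Suc n)
  have "hecke_w q (Suc n) = hecke_U q *v hecke_w q n"
    by (simp add: hecke_w_def)
  also have "\<dots> = vector [lam * sg (int n + 1) - sg (int n), sg (int n + 1)]"
    unfolding Suc by (simp add: hecke_U_def hecke_S_m2 hecke_T_m2 m2_mult_vec)
  moreover have "sg (int n + 1 + 1) = lam * sg (int n + 1) - sg (int n)"
    using sg_rec[of "int n + 1"] by simp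
  moreover have "int (Suc n) = int n + 1" by simp
  ultimately show ?case by (simp only:)
qed (simp add: hecke_w_def)

lemma rho_gap: "rho a b k - rho a b (k + 1) = a * (sg k - sg (k - 1)) + b * (sg k - sg (k + 1))"
  by (simp add: rho_def algebra_simps)

lemma sg_steps: "sg k - sg (k - 1) \<le> 1" "sg k - sg (k + 1) \<le> 1"
  using sg_diff_le_1[of k] sg_diff_le_1[of "k - 1"] by auto

text \<open>This is the side inequality at the point (1, 1). After multiplication by
  \<open>lam\<close> the left side combines two differences of neighbouring values with weights 1
  and \<open>lam - 1\<close>.\<close>

lemma sg_small: "(2 - lam) * sg k \<le> 1"
proof -
  have 2: "sg (k - 1 - 1) = lam * sg (k - 1) - sg k" using sg_rec[of "k - 1"] by simp
  have "lam * ((2 - lam) * sg k) = (sg (k - 1) - sg (k - 1 - 1)) + (lam - 1) * (sg k - sg (k + 1))"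
    unfolding 2 sg_rec[of k] by (simp add: algebra_simps)
  also have "\<dots> \<le> 1 + (lam - 1) * 1"
    using sg_steps(1)[of "k - 1"] sg_steps(2)[of k] lam_ge_1 by (intro add_mono mult_left_mono) auto
  finally have "lam * ((2 - lam) * sg k) \<le> lam * 1" by simp
  then show ?thesis using lam_ge_1 by simp
qed

lemma sg_near_q: "sg (int q - 1) = 1" "sg (int q - 2) = lam" "sg (int q + 1) = - 1"
  using sg_diff_q[of 1] sg_diff_q[of 2] sg_add_q[of 1] by (simp_all add: add.commute)

lemma poly_row_edges:
  assumes "\<forall>k. 0 < k \<and> k < int q \<longrightarrow> rho a b k - rho a b (k + 1) \<le> 1"
  shows "a \<le> 1 + (lam - 1) * b" "b \<le> 1 + (lam - 1) * a"
proof -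
  have "rho a b 1 - rho a b (1 + 1) \<le> 1"
    by (rule assms[rule_format]) (use q_ge_3 in simp)
  then show "a \<le> 1 + (lam - 1) * b" unfolding rho_gap by (simp add: algebra_simps)
  have "rho a b (int q - 1) - rho a b (int q - 1 + 1) \<le> 1"
    by (rule assms[rule_format]) (use q_ge_3 in simp)
  then show "b \<le> 1 + (lam - 1) * a" unfolding rho_gap using sg_near_q by (simp add: algebra_simps)
qed

text \<open>Insert one of the two extreme side inequalities into the other. The bound later makes
  the gap between horocycle return times uniform.\<close>

lemma poly_row_bound:
  assumes "poly_row a b"
  shows "a \<le> 1 / (2 - lam)"
proof -
  define x where "x = a * (2 - lam)"
  have "a \<le> 1 + (lam - 1) * b" "b \<le> 1 + (lam - 1) * a"
    using poly_row_edges[of a b] assms by (auto simp: poly_row_def)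
  then have "a \<le> 1 + (lam - 1) * (1 + (lam - 1) * a)"
    using lam_ge_1 mult_left_mono[of b "1 + (lam - 1) * a" "lam - 1"] by linarith
  also have "\<dots> = lam + a - lam * x"
    by (simp add: x_def algebra_simps)
  finally have "lam * x \<le> lam * 1" by simp
  then have "a * (2 - lam) \<le> 1"
    using lam_ge_1 unfolding x_def[symmetric] by (auto intro: mult_left_le_imp_le[of lam x 1])
  then show ?thesis using lam_less_2 by (simp add: pos_le_divide_eq)
qed

lemma convex_polygon_region:
  "convex {u :: real^2. 0 \<le> u $ 1 \<and> 0 \<le> u $ 2 \<and> 1 \<le> u $ 1 + u $ 2 \<and>
     (\<forall>k. 0 < k \<and> k < int q \<longrightarrow> rho (u $ 1) (u $ 2) k - rho (u $ 1) (u $ 2) (k + 1) \<le> 1)}"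
    (is "convex ?C")
proof (rule convexI)
  fix x y :: "real^2" and u v :: real
  assume xy: "x \<in> ?C" "y \<in> ?C" and uv: "0 \<le> u" "0 \<le> v" "u + v = 1"
  define z where "z = u *\<^sub>R x + v *\<^sub>R y"
  have z: "z $ 1 = u * x $ 1 + v * y $ 1" "z $ 2 = u * x $ 2 + v * y $ 2"
    by (simp_all add: z_def)
  have "u * 1 + v * 1 \<le> u * (x $ 1 + x $ 2) + v * (y $ 1 + y $ 2)"
    using xy uv by (intro add_mono mult_left_mono) auto
  then have "1 \<le> u * (x $ 1 + x $ 2) + v * (y $ 1 + y $ 2)"
    using uv by simp
  moreover have "rho (z $ 1) (z $ 2) k - rho (z $ 1) (z $ 2) (k + 1) \<le> 1" if "0 < k \<and> k < int q" for k
  proof -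
    have "rho (z $ 1) (z $ 2) k - rho (z $ 1) (z $ 2) (k + 1) =
      u * (rho (x $ 1) (x $ 2) k - rho (x $ 1) (x $ 2) (k + 1)) +
      v * (rho (y $ 1) (y $ 2) k - rho (y $ 1) (y $ 2) (k + 1))"
      unfolding rho_gap z by (simp add: algebra_simps)
    also have "\<dots> \<le> 1"
      using xy uv that by (intro convex_bound_le) auto
    finally show ?thesis .
  qed
  ultimately show "u *\<^sub>R x + v *\<^sub>R y \<in> ?C"
    unfolding z_def[symmetric] using xy uv z by (auto simp: algebra_simps)
qed

lemma hecke_w_ends: "hecke_w q 0 = vector [1, 0]" "hecke_w q (q - Suc 0) = vector [0, 1]"
proof -
  have "int (q - Suc 0) = int q - 1" using q_ge_3 by simp
  then show "hecke_w q (q - Suc 0) = vector [0, 1]"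
    unfolding hecke_w_eq using sg_near_q by simp
qed (simp add: hecke_w_eq)

text \<open>The hull lies in the half-planes because its vertices do. Conversely, the ray from the
  origin through \<open>u\<close> meets the removed segment and an outer side, and \<open>u\<close>
  lies between these two points.\<close>

lemma hecke_polygon_iff: "u \<in> hecke_polygon q \<longleftrightarrow> poly_row (u $ 1) (u $ 2)"
proof
  let ?C = "{u :: real^2. 0 \<le> u $ 1 \<and> 0 \<le> u $ 2 \<and> 1 \<le> u $ 1 + u $ 2 \<and>
     (\<forall>k. 0 < k \<and> k < int q \<longrightarrow> rho (u $ 1) (u $ 2) k - rho (u $ 1) (u $ 2) (k + 1) \<le> 1)}"
  assume u: "u \<in> hecke_polygon q"
  have "hecke_w q ` {0..q - 1} \<subseteq> ?C"
  proof
    fix w assume "w \<in> hecke_w q ` {0..q - 1}"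
    then obtain i where i: "i \<le> q - 1" "w = vector [sg (int i + 1), sg (int i)]"
      by (auto simp: hecke_w_eq)
    have nn: "0 \<le> sg (int i)" "0 \<le> sg (int i + 1)"
      using i q_ge_3 by (auto intro!: sg_nonneg)
    have "1 \<le> sg (int i + 1) + sg (int i)"
    proof (cases "i = 0")
      case False
      moreover have "i < q" using i q_ge_3 by linarith
      ultimately show ?thesis using nn sg_ge_1[of "int i"] by simp
    qed simp
    moreover have "rho (sg (int i + 1)) (sg (int i)) k - rho (sg (int i + 1)) (sg (int i)) (k + 1) \<le> 1" for k
    proof -
      \<comment> \<open>On a vertex \<open>rho\<close> is \<open>sg\<close> read backwards, so the
        inequality is \<open>sg_steps\<close>.\<close>
      have r: "rho (sg (int i + 1)) (sg (int i)) k = sg (int i + 1 - k)" for k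
        using sg_cross[of "int i" "k - 1"] sg_minus[of "k - 1 - int i"]
        by (simp add: rho_def algebra_simps)
      show ?thesis unfolding r using sg_steps(1)[of "int i + 1 - k"] by (simp add: algebra_simps)
    qed
    ultimately show "w \<in> ?C" using nn by (simp add: i)
  qed
  then have "convex hull (hecke_w q ` {0..q - 1}) \<subseteq> ?C"
    by (rule hull_minimal) (rule convex_polygon_region)
  then have C: "u \<in> ?C" using u by (auto simp: hecke_polygon_def)
  have "u \<in> closed_segment (hecke_w q 0) (hecke_w q (q - 1))" if "u $ 1 + u $ 2 = 1"
  proof -
    have "u = (1 - u $ 2) *\<^sub>R hecke_w q 0 + u $ 2 *\<^sub>R hecke_w q (q - 1)"
      using that by (simp add: hecke_w_ends vec_eq_iff forall_2)
    then show ?thesis using C that unfolding closed_segment_def by force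
  qed
  then have "1 < u $ 1 + u $ 2"
    using u C unfolding hecke_polygon_def by force
  \<comment> \<open>On a coordinate axis the two extreme sides leave only points with coordinate sum
    at most 1.\<close>
  moreover have "u $ 1 \<le> 1 + (lam - 1) * u $ 2" "u $ 2 \<le> 1 + (lam - 1) * u $ 1"
    using C poly_row_edges by auto
  then have "u $ 1 \<noteq> 0" "u $ 2 \<noteq> 0"
    using \<open>1 < u $ 1 + u $ 2\<close> by auto
  ultimately show "poly_row (u $ 1) (u $ 2)"
    using C by (auto simp: poly_row_def)
next
  define a b where ab: "a = u $ 1" "b = u $ 2"
  assume "poly_row (u $ 1) (u $ 2)"
  then have P: "0 < a" "0 < b" "1 < a + b" 
    "\<And>k. 0 < k \<Longrightarrow> k < int q \<Longrightarrow> rho a b k - rho a b (k + 1) \<le> 1"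
    by (auto simp: poly_row_def ab)
  have "rho a b (int q) = - a"
    using rho_add_q[of a b 0] by simp
  \<comment> \<open>The sign change singles out the cone spanned by w_(k-1) and w_k that contains
    \<open>u\<close>; up to sign the two values are the coordinates of \<open>u\<close> in this
    basis.\<close>
  then obtain k where k: "1 \<le> k" "k < int q" "0 \<le> rho a b k" "\<not> 0 \<le> rho a b (k + 1)"
    using int_switch[of "\<lambda>k. 0 \<le> rho a b k" 1 "int q"] P(1,2) q_ge_3 by auto
  define \<alpha> \<beta> where \<alpha>\<beta>: "\<alpha> = - rho a b (k + 1)" "\<beta> = rho a b k"
  define r t where rt: "r = \<alpha> + \<beta>" "t = a + b"
  have \<alpha>: "0 < \<alpha>" "0 \<le> \<beta>" "0 < r" "r \<le> 1" "1 < t"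
    using k P(3) P(4)[of k] by (auto simp: \<alpha>\<beta> rt)
  let ?H = "convex hull (hecke_w q ` {0..q - 1})"
  define w1 w2 where w: "w1 = hecke_w q (nat (k - 1))" "w2 = hecke_w q (nat k)"
  have wH: "w1 \<in> ?H" "w2 \<in> ?H" "hecke_w q 0 \<in> ?H" "hecke_w q (q - 1) \<in> ?H"
    unfolding w using k q_ge_3 by (auto intro!: hull_inc)
  \<comment> \<open>\<open>p\<close> is u/r on the outer side and \<open>s\<close> is u/t on the
    removed segment, with r \<le> 1 < t.\<close>
  define p s where p: "p = (\<alpha> / r) *\<^sub>R w1 + (\<beta> / r) *\<^sub>R w2"
    and s: "s = (a / t) *\<^sub>R hecke_w q 0 + (b / t) *\<^sub>R hecke_w q (q - 1)"
  have "p \<in> ?H" unfolding p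
    using \<alpha> by (intro convexD[OF convex_convex_hull] wH) (auto simp: rt add_divide_distrib[symmetric])
  moreover have "s \<in> ?H" unfolding s
    using \<alpha> P by (intro convexD[OF convex_convex_hull] wH) (auto simp: rt add_divide_distrib[symmetric])
  \<comment> \<open>The weights x, y solve x + y = 1 and x/r + y/t = 1.\<close>
  ultimately have inH: "(r * (t - 1) / (t - r)) *\<^sub>R p + (t * (1 - r) / (t - r)) *\<^sub>R s \<in> ?H"
    using \<alpha> by (intro convexD[OF convex_convex_hull]) (auto simp: add_divide_distrib[symmetric] algebra_simps)
  have det: "sg k * sg k - sg (k + 1) * sg (k - 1) = 1"
    using det_W[of k] by (simp add: W_def)
  have w': "w1 $ 1 = sg k" "w1 $ 2 = sg (k - 1)" "w2 $ 1 = sg (k + 1)" "w2 $ 2 = sg k"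
    using k by (simp_all add: w hecke_w_eq)
  have "\<alpha> * sg k + \<beta> * sg (k + 1) = a * (sg k * sg k - sg (k + 1) * sg (k - 1))"
    "\<alpha> * sg (k - 1) + \<beta> * sg k = b * (sg k * sg k - sg (k + 1) * sg (k - 1))"
    by (simp_all add: \<alpha>\<beta> rho_def algebra_simps)
  then have "\<alpha> *\<^sub>R w1 + \<beta> *\<^sub>R w2 = u"
    unfolding det by (simp add: vec_eq_iff forall_2 w' ab)
  then have p': "r *\<^sub>R p = u"
    using \<alpha> by (simp add: p scaleR_add_right)
  have s': "t *\<^sub>R s = u"
    using \<alpha> by (simp add: s scaleR_add_right hecke_w_ends vec_eq_iff forall_2 ab)
  have "(r * (t - 1) / (t - r)) *\<^sub>R p + (t * (1 - r) / (t - r)) *\<^sub>R s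
     = ((t - 1) / (t - r)) *\<^sub>R r *\<^sub>R p + ((1 - r) / (t - r)) *\<^sub>R t *\<^sub>R s"
    by (simp add: mult.commute)
  also have "\<dots> = ((t - 1) / (t - r) + (1 - r) / (t - r)) *\<^sub>R u"
    unfolding p' s' by (simp add: scaleR_add_left)
  also have "(t - 1) / (t - r) + (1 - r) / (t - r) = 1"
    using \<alpha> by (simp add: add_divide_distrib[symmetric])
  finally have "u \<in> ?H" using inH by simp
  moreover have "u \<notin> closed_segment (hecke_w q 0) (hecke_w q (q - 1))"
    using P(3) by (auto simp: closed_segment_def hecke_w_ends ab)
  ultimately show "u \<in> hecke_polygon q" by (simp add: hecke_polygon_def)
qed


subsection \<open>The Farey triangle\<close>

text \<open>Up to an index shift these are the \<open>rho\<close> sequences, now parametrised by the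
  values at 0 and q - 1 instead of two neighbouring ones.\<close>

definition dseq :: "real \<Rightarrow> real \<Rightarrow> int \<Rightarrow> real" where
  "dseq a b k = a * sg (k + 1) + b * sg k"

lemma rho_dseq: "rho (- b) a k = dseq a b (k - 1)"
  by (simp add: rho_def dseq_def)

text \<open>The second parameter is the value of \<open>rho\<close> at l + q - 1, by
  antiperiodicity.\<close>

lemma dseq_rho: "dseq (rho a b l) (- rho a b (l - 1)) k = rho a b (l + k)"
  using rho_rho[of a b "l - 1" "k + 1"] rho_dseq[of "- rho a b (l - 1)" "rho a b l" "k + 1"] by simp

lemma dseq_values [simp]: "dseq a b 0 = a" "dseq a b 1 = lam * a + b" "dseq a b (int q - 1) = b"
  "dseq a b (int q - 2) = a + lam * b"
  using sg_near_q by (simp_all add: dseq_def algebra_simps)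

lemma dseq_rec: "dseq a b (k + 1) = lam * dseq a b k - dseq a b (k - 1)"
  using rho_rec[of "- b" a "k + 1"] by (simp add: rho_dseq add.commute)

lemma dseq_det: "dseq a b j * dseq c d k - dseq c d j * dseq a b k = (a * d - b * c) * sg (k - j)"
  using rho_cross[of "- b" a "j + 1" "- d" c "k + 1"] by (simp add: rho_dseq algebra_simps)

text \<open>Where the sequence is positive, its second difference -(2 - \<open>lam\<close>) times
  the value is negative, so a descent continues. A value above 1 at \<open>m\<close> would force
  positivity up to \<open>m\<close>.\<close>

lemma dseq_no_return:
  assumes "0 < a" "1 \<le> i" "i \<le> m" "m < int q" "1 < dseq a b (i - 1)" "dseq a b i \<le> 1"
  shows "dseq a b m \<le> 1"
proof (rule ccontr)
  assume "\<not> ?thesis"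
  then have m: "1 < dseq a b m" by simp
  have pos: "0 < dseq a b n" if "0 \<le> n" "n \<le> m" for n
  proof (cases "n = m")
    case False
    have sgm: "0 < sg m" "0 < sg (m - n)" "0 \<le> sg n"
      using assms that False by (auto intro: sg_pos sg_nonneg)
    \<comment> \<open>Intermediate values are nonnegative combinations of those at 0 and
      \<open>m\<close>.\<close>
    have "dseq a b n * sg m = dseq a b m * sg n + a * sg (m - n)"
      using sg_cross[of n m] by (simp add: dseq_def algebra_simps flip: sg_cross[of n m])
    also have "\<dots> > 0" using m sgm assms(1) by (intro add_nonneg_pos mult_nonneg_nonneg mult_pos_pos) auto
    finally show ?thesis using sgm by (simp add: zero_less_mult_iff)
  qed (use m in simp)
  have "k \<le> m \<longrightarrow> dseq a b k \<le> 1 \<and> dseq a b k < dseq a b (k - 1)" if "i \<le> k" for k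
    using that
  proof (induction k rule: int_ge_induct)
    case (step k)
    show ?case
    proof
      assume "k + 1 \<le> m"
      then have k: "dseq a b k \<le> 1" "dseq a b k < dseq a b (k - 1)" "0 < dseq a b k"
        using step pos[of k] assms(2) by auto
      have "(2 - lam) * dseq a b k > 0" using k(3) lam_less_2 by simp
      then have "dseq a b (k + 1) < dseq a b k"
        unfolding dseq_rec[of a b k] using k(2) by (simp add: algebra_simps)
      then show "dseq a b (k + 1) \<le> 1 \<and> dseq a b (k + 1) < dseq a b (k + 1 - 1)"
        using k(1) by simp
    qed
  qed (use assms in auto)
  from this[of m] show False using m assms by auto
qed

text \<open>\<open>in_tri\<close> and \<open>tri_index\<close> are \<open>farey_triangle\<close> and \<open>farey_piece\<close> in coordinates: \<open>dseq a b k\<close> is the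
  inner product of \<open>(a, b)\<close> with \<open>w\<^sub>k\<close>.\<close>

definition in_tri :: "real \<Rightarrow> real \<Rightarrow> bool" where
  "in_tri a b \<longleftrightarrow> 0 < a \<and> a \<le> 1 \<and> 1 - lam * a < b \<and> b \<le> 1"

definition tri_index :: "real \<Rightarrow> real \<Rightarrow> int \<Rightarrow> bool" where
  "tri_index a b i \<longleftrightarrow> 2 \<le> i \<and> i < int q \<and> 1 < dseq a b (i - 1) \<and> dseq a b i \<le> 1"

lemma dseq_energy:
  assumes "0 \<le> k"
  shows "(dseq a b k)\<^sup>2 + (dseq a b (k - 1))\<^sup>2 - lam * dseq a b k * dseq a b (k - 1) = a\<^sup>2 + b\<^sup>2 + lam * a * b"
  using assms
proof (induction k rule: int_ge_induct)
  case base
  have "dseq a b (- 1) = - b" using sg_minus[of 1] by (simp add: dseq_def)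
  then show ?case by simp
next
  case (step k)
  then show ?case
    unfolding add_diff_cancel_right' dseq_rec[of a b k] by (simp add: power2_eq_square algebra_simps)
qed

text \<open>For b \<le> 0, a nonpositive value right after one above 1 would make the invariant form
  exceed 1, yet it equals a^2 + b (b + \<open>lam\<close> a) \<le> 1.\<close>

lemma tri_index_pos:
  assumes "in_tri a b" "tri_index a b i"
  shows "0 < dseq a b i"
proof (cases "0 < b")
  case True
  have "0 < sg i" "0 \<le> sg (i + 1)"
    using assms by (auto simp: tri_index_def intro: sg_pos sg_nonneg)
  then show ?thesis
    using True assms(1) by (auto simp: dseq_def in_tri_def intro: add_nonneg_pos)
next
  case False
  show ?thesis
  proof (rule ccontr)
    assume n: "\<not> 0 < dseq a b i"
    have 1: "1 < dseq a b (i - 1)" "0 \<le> i" using assms by (auto simp: tri_index_def)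
    have ab: "0 < a" "a \<le> 1" "1 - lam * a < b" using assms by (auto simp: in_tri_def)
    have "lam * dseq a b i * dseq a b (i - 1) \<le> 0"
      using n 1 lam_ge_1 by (simp add: mult_nonneg_nonpos mult_nonpos_nonneg)
    moreover have "1 < (dseq a b (i - 1))\<^sup>2" using 1 by (simp add: one_less_power)
    ultimately have "1 < a\<^sup>2 + b\<^sup>2 + lam * a * b"
      using dseq_energy[OF 1(2), of a b] zero_le_power2[of "dseq a b i"] by linarith
    moreover have "a\<^sup>2 \<le> 1" using ab by (simp add: abs_square_le_1)
    moreover have "b * (b + lam * a) \<le> 0"
      using False ab by (intro mult_nonpos_nonneg) auto
    ultimately show False by (simp add: power2_eq_square algebra_simps)
  qed
qed

text \<open>An earlier drop to 1 or below would be final by \<open>dseq_no_return\<close>.\<close>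

lemma tri_index_below:
  assumes "in_tri a b" "tri_index a b i" "1 \<le> k" "k < i"
  shows "1 < dseq a b k"
proof (rule ccontr)
  assume n: "\<not> ?thesis"
  have "1 < dseq a b 1" using assms by (simp add: in_tri_def)
  then obtain j where j: "1 \<le> j" "j < k" "1 < dseq a b j" "\<not> 1 < dseq a b (j + 1)"
    using n assms(3) int_switch[of "\<lambda>k. 1 < dseq a b k" 1 k] by auto
  have "dseq a b (i - 1) \<le> 1"
    by (rule dseq_no_return[of a "j + 1" "i - 1"])
      (use j assms in \<open>auto simp: in_tri_def tri_index_def\<close>)
  then show False using assms by (simp add: tri_index_def)
qed

lemma tri_index_ex:
  assumes "in_tri a b"
  obtains i where "tri_index a b i"
proof -
  have "1 < dseq a b 1" "\<not> 1 < dseq a b (int q - 1)"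
    using assms by (auto simp: in_tri_def)
  then obtain j where "1 \<le> j" "j < int q - 1" "1 < dseq a b j" "\<not> 1 < dseq a b (j + 1)"
    using q_ge_3 int_switch[of "\<lambda>k. 1 < dseq a b k" 1 "int q - 1"] by auto
  then show thesis using that[of "j + 1"] by (auto simp: tri_index_def)
qed

lemma tri_index_unique:
  assumes "in_tri a b" "tri_index a b i" "tri_index a b k"
  shows "i = k"
proof -
  have "\<not> i < k" if "tri_index a b i" "tri_index a b k" for i k
    using tri_index_below[OF assms(1) that(2), of i] that(1) by (auto simp: tri_index_def)
  from this[of i k] this[of k i] assms show ?thesis by force
qed

lemma farey_triangle_iff: "u \<in> farey_triangle q \<longleftrightarrow> in_tri (u $ 1) (u $ 2)"
  by (simp add: farey_triangle_def in_tri_def)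

lemma inner_hecke_w: "u \<bullet> hecke_w q n = dseq (u $ 1) (u $ 2) (int n)"
  by (simp add: inner_vec_def sum_2 hecke_w_eq dseq_def)

lemma farey_roof_eq:
  assumes "in_tri (u $ 1) (u $ 2)" "tri_index (u $ 1) (u $ 2) i"
  shows "farey_roof q u = sg i / (u $ 1 * dseq (u $ 1) (u $ 2) i)"
proof -
  have iff: "n \<in> {2..q - 1} \<and> u \<in> farey_piece q n \<longleftrightarrow> tri_index (u $ 1) (u $ 2) (int n)" for n
  proof (cases "2 \<le> n")
    case True
    then have "int (n - 1) = int n - 1" by simp
    with True q_ge_3 show ?thesis
      using assms(1) by (auto simp: farey_piece_def farey_triangle_iff inner_hecke_w tri_index_def)
  qed (auto simp: tri_index_def)
  have "farey_index q u = nat i"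
    unfolding farey_index_def iff
  proof (rule the_equality)
    show "tri_index (u $ 1) (u $ 2) (int (nat i))" using assms(2) by (simp add: tri_index_def)
  next
    fix n assume "tri_index (u $ 1) (u $ 2) (int n)"
    from tri_index_unique[OF assms(1) this assms(2)] show "n = nat i" by simp
  qed
  moreover have "0 \<le> i" using assms(2) by (simp add: tri_index_def)
  ultimately show ?thesis
    by (simp add: farey_roof_def inner_hecke_w) (simp add: hecke_w_eq)
qed


subsection \<open>The bijection\<close>

text \<open>The point is a convex combination of (1, 0), (0, 1), (1, 1) with weights 1 - b, 1 - a, a
  + b - 1, and the side inequalities hold at these three points.\<close>

lemma poly_row_square:
  assumes "0 < a" "a \<le> 1" "0 < b" "b \<le> 1" "1 < a + b"
  shows "poly_row a b"
proof -
  have "rho a b k - rho a b (k + 1) \<le> 1" for k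
  proof -
    define A B where AB: "A = sg k - sg (k - 1)" "B = sg k - sg (k + 1)"
    have "A + B = (2 - lam) * sg k"
      using sg_rec[of k] by (simp add: AB algebra_simps)
    then have AB1: "A \<le> 1" "B \<le> 1" "A + B \<le> 1"
      using sg_steps[of k] sg_small[of k] by (auto simp: AB)
    have "rho a b k - rho a b (k + 1) = (1 - b) * A + (1 - a) * B + (a + b - 1) * (A + B)"
      unfolding rho_gap AB by (simp add: algebra_simps)
    also have "\<dots> \<le> (1 - b) * 1 + (1 - a) * 1 + (a + b - 1) * 1"
      using assms AB1 by (intro add_mono mult_left_mono) auto
    finally show ?thesis by simp
  qed
  then show ?thesis using assms by (simp add: poly_row_def)
qed

text \<open>The same argument for the triangle with vertices (1, 0), (0, 1), (1, 1 -
  \<open>lam\<close>). The hypotheses exclude \<open>lam = 1\<close>, so \<open>lam - 1\<close> can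
  be cancelled.\<close>

lemma dseq_gap_le_1:
  assumes "in_tri a b" "a + b \<le> 1"
  shows "dseq a b k - dseq a b (k + 1) \<le> 1"
proof -
  have ab: "0 < a" "a \<le> 1" "1 - lam * a < b" using assms by (auto simp: in_tri_def)
  have "lam \<noteq> 1" using ab assms(2) by auto
  then have l: "0 < lam - 1" using lam_ge_1 by simp
  define P Q where PQ: "P = sg (k + 1) - sg (k + 1 + 1)" "Q = sg k - sg (k + 1)"
  have "P + (1 - lam) * Q = (2 - lam) * sg k"
    using sg_rec[of "k + 1"] by (simp add: PQ algebra_simps)
  then have 1: "P \<le> 1" "Q \<le> 1" "P + (1 - lam) * Q \<le> 1"
    using sg_steps(2)[of k] sg_steps(2)[of "k + 1"] sg_small[of k] by (auto simp: PQ)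
  have "(lam - 1) * (a * P + b * Q) =
      ((lam - 1) * a - (1 - a - b)) * P + ((lam - 1) * (1 - a)) * Q + (1 - a - b) * (P + (1 - lam) * Q)"
    by (simp add: algebra_simps)
  also have "\<dots> \<le> ((lam - 1) * a - (1 - a - b)) * 1 + ((lam - 1) * (1 - a)) * 1 + (1 - a - b) * 1"
  proof (intro add_mono mult_left_mono)
    show "0 \<le> (lam - 1) * a - (1 - a - b)" using ab by (simp add: algebra_simps)
    show "0 \<le> (lam - 1) * (1 - a)" using l ab by simp
  qed (use 1 assms(2) in auto)
  also have "\<dots> = (lam - 1) * 1" by (simp add: algebra_simps)
  finally have "a * P + b * Q \<le> 1" using l by (rule mult_left_le_imp_le)
  then show ?thesis by (simp add: dseq_def PQ algebra_simps)
qed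

text \<open>Between the strip vectors of index 0 and \<open>i\<close> on one polygon the second row
  changes sign; the side where this happens is the crossed one.\<close>

lemma suspension_to_polygon:
  assumes tri: "in_tri a b" and i: "tri_index a b i" and det: "a * d - b * c = 1"
    and "c \<le> 0" "0 < dseq c d i"
  obtains \<gamma> where "\<gamma> \<in> hecke_group q" "crossing (m2 a b c d ** \<gamma>)"
    "poly_row ((m2 a b c d ** \<gamma>) $ 1 $ 1) ((m2 a b c d ** \<gamma>) $ 1 $ 2)"
proof (cases "1 < a + b")
  case True
  have ab: "0 < a" "a \<le> 1" "0 < b" "b \<le> 1" using tri True by (auto simp: in_tri_def)
  \<comment> \<open>When a + b > 1 the pair itself is already the side sought; the index q - 1 turns
    the roof condition into d > 0.\<close>
  have "i = int q - 1"
  proof (rule ccontr)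
    assume "i \<noteq> int q - 1"
    have "dseq a b (int q - 2) \<le> 1"
      by (rule dseq_no_return[of a i]) (use \<open>i \<noteq> int q - 1\<close> i ab in \<open>auto simp: tri_index_def\<close>)
    then have "a + lam * b \<le> 1" by simp
    then show False using True ab lam_ge_1 mult_right_mono[of 1 lam b] by linarith
  qed
  then have "0 < d" using assms(5) by simp
  then show thesis
    using that[of "mat 1"] hecke_group_one poly_row_square[OF ab True] ab assms(4)
    by (simp add: crossing_def)
next
  case False
  have ab: "0 < a" using tri by (simp add: in_tri_def)
  have i': "2 \<le> i" "i < int q" "1 < dseq a b (i - 1)" using i by (auto simp: tri_index_def)
  obtain j where j: "0 \<le> j" "j < i" "dseq c d j \<le> 0" "0 < dseq c d (j + 1)"
    using int_switch[of "\<lambda>k. dseq c d k \<le> 0" 0 i] assms(4,5) i' by auto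
  define X where "X = m2 a b c d ** W (j + 1)"
  have X: "X $ 1 $ 1 = dseq a b j" "X $ 1 $ 2 = dseq a b (j + 1)"
    "X $ 2 $ 1 = dseq c d j" "X $ 2 $ 2 = dseq c d (j + 1)"
    by (simp_all add: X_def matrix_mult_2_nth W_def dseq_def add.commute)
  have pos: "0 < dseq a b k" if "0 \<le> k" "k \<le> i" for k
    using that tri_index_below[OF tri i, of k] tri_index_pos[OF tri i] ab by (cases "k = 0 \<or> k = i") auto
  have sum: "1 < dseq a b j + dseq a b (j + 1)"
  proof (cases "j = i - 1")
    case True
    then show ?thesis using i' pos[of i] by simp
  next
    case False
    then show ?thesis
      using tri_index_below[OF tri i, of "j + 1"] pos[of j] j by simp
  qed
  have gap: "rho (dseq a b j) (dseq a b (j + 1)) k - rho (dseq a b j) (dseq a b (j + 1)) (k + 1) \<le> 1" for k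
  proof -
    have r: "rho (dseq a b j) (dseq a b (j + 1)) k = dseq a b (j + k)" for k
      using rho_rho[of "- b" a "j + 1" k] by (simp add: rho_dseq algebra_simps)
    show ?thesis
      unfolding r using dseq_gap_le_1[OF tri, of "j + k"] False by (simp add: add.assoc)
  qed
  show thesis
  proof (rule that)
    show "W (j + 1) \<in> hecke_group q" using j by (intro W_in_group) auto
    show "crossing (m2 a b c d ** W (j + 1))"
      using X j pos[of j] pos[of "j + 1"] unfolding X_def[symmetric] by (simp add: crossing_def)
    show "poly_row ((m2 a b c d ** W (j + 1)) $ 1 $ 1) ((m2 a b c d ** W (j + 1)) $ 1 $ 2)"
      unfolding X_def[symmetric] X poly_row_def using gap sum j pos[of j] pos[of "j + 1"] by simp
  qed
qed

text \<open>From the crossed side, with indices 0 and 1, walk both ways around its polygon until the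
  first row drops to 1 or below. The stopping indices \<open>l\<close> and \<open>r\<close> give two
  consecutive strip vectors.\<close>

lemma polygon_to_suspension:
  assumes cr: "crossing X" and det: "det X = 1" and poly: "poly_row (X $ 1 $ 1) (X $ 1 $ 2)"
  obtains \<gamma> a b c d i where "\<gamma> \<in> hecke_group q" "X ** \<gamma> = m2 a b c d" "in_tri a b"
    "tri_index a b i" "c \<le> 0" "0 < dseq c d i"
proof -
  obtain \<alpha> \<beta> \<delta> \<kappa> where X: "X = m2 \<alpha> \<beta> \<delta> \<kappa>" by (rule m2_cases)
  have signs: "0 < \<alpha>" "0 < \<beta>" "\<delta> \<le> 0" "0 < \<kappa>" "\<alpha> * \<kappa> - \<beta> * \<delta> = 1" "1 < \<alpha> + \<beta>"
    using cr det poly by (auto simp: X crossing_def poly_row_def)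
  show thesis
  proof (cases "\<alpha> \<le> 1 \<and> \<beta> \<le> 1")
    \<comment> \<open>Both ends are in the strip already. The walk would stop with r - l = 1, not
      the index of a piece; the matrix itself works with index q - 1.\<close>
    case True
    have l: "1 < lam * \<alpha> + \<beta>" "1 < \<alpha> + lam * \<beta>"
      using signs lam_ge_1 mult_right_mono[of 1 lam \<alpha>] mult_right_mono[of 1 lam \<beta>] by linarith+
    have "in_tri \<alpha> \<beta>" "tri_index \<alpha> \<beta> (int q - 1)"
      using True signs l q_ge_3 by (auto simp: in_tri_def tri_index_def)
    then show thesis
      using that[of "mat 1" \<alpha> \<beta> \<delta> \<kappa> "int q - 1"] signs hecke_group_one by (simp add: X)
  next
    case False
    define e f where ef: "e = rho \<alpha> \<beta>" "f = rho \<delta> \<kappa>"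
    have e01: "e 0 = \<alpha>" "e 1 = \<beta>" "f 0 = \<delta>" "f 1 = \<kappa>" by (simp_all add: ef)
    have eq: "e (k + int q) = - e k" for k by (simp add: ef rho_add_q)
    have gap: "e k \<le> 1 + e (k + 1)" if "0 < k" "k < int q" for k
      using poly that by (auto simp: X poly_row_def ef)
    have gap': "e (k + 1) \<le> 1 + e k" if "- int q < k" "k < 0" for k
      using gap[of "k + int q"] that eq[of k] eq[of "k + 1"] by (simp add: algebra_simps)
    have "e (int q) = - \<alpha>" using eq[of 0] e01 by simp
    \<comment> \<open>Index 0 is exempt because its value may be at most 1; the leftward search
      exempts index 1 likewise.\<close>
    then have "\<not> (int q = 0 \<or> 1 < e (int q))" using signs q_ge_3 by simp
    then obtain r' where r': "0 \<le> r'" "r' < int q" "\<And>m. 0 \<le> m \<Longrightarrow> m \<le> r' \<Longrightarrow> m = 0 \<or> 1 < e m"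
      "\<not> (r' + 1 = 0 \<or> 1 < e (r' + 1))"
      by (rule int_first_failure[of "\<lambda>m. m = 0 \<or> 1 < e m" 0 "int q", rotated]) simp_all
    define r where "r = r' + 1"
    have r: "1 \<le> r" "r \<le> int q" "\<And>m. 0 < m \<Longrightarrow> m < r \<Longrightarrow> 1 < e m" "e r \<le> 1"
    proof -
      show "1 < e m" if "0 < m" "m < r" for m using r'(3)[of m] that by (simp add: r_def)
    qed (use r'(1,2,4) in \<open>simp_all add: r_def\<close>)
    \<comment> \<open>A side inequality limits each drop to 1, so the first value at most 1 after
      one above 1 is still positive.\<close>
    have er: "0 < e r"
    proof (cases "r = 1")
      case False
      then show ?thesis using gap[of "r - 1"] r(3)[of "r - 1"] r(1,2) by simp
    qed (use e01 signs in simp)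
    have "e (1 - int q) = - \<beta>" using eq[of "1 - int q"] e01 by simp
    then have "\<not> (1 - int q = 1 \<or> 1 < e (1 - int q))" using signs q_ge_3 by simp
    then obtain l' where l': "1 - int q < l'" "l' \<le> 1" "\<And>m. l' \<le> m \<Longrightarrow> m \<le> 1 \<Longrightarrow> m = 1 \<or> 1 < e m"
      "\<not> (l' - 1 = 1 \<or> 1 < e (l' - 1))"
      by (rule int_last_failure[of "\<lambda>m. m = 1 \<or> 1 < e m" 1 "1 - int q", rotated]) simp_all
    define l where "l = l' - 1"
    have l: "1 - int q \<le> l" "l \<le> 0" "\<And>m. l < m \<Longrightarrow> m \<le> 0 \<Longrightarrow> 1 < e m" "e l \<le> 1"
    proof -
      show "1 < e m" if "l < m" "m \<le> 0" for m using l'(3)[of m] that by (simp add: l_def)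
    qed (use l'(1,2,4) in \<open>simp_all add: l_def\<close>)
    have el: "0 < e l"
    proof (cases "l = 0")
      case False
      then show ?thesis using gap'[of l] l(3)[of "l + 1"] l(1,2) by simp
    qed (use e01 signs in simp)
    have between: "1 < e m" if "l < m" "m < r" for m
      using l(3)[of m] r(3)[of m] that by (cases "m \<le> 0") auto
    have rl: "l + 2 \<le> r"
    proof (rule ccontr)
      assume "\<not> l + 2 \<le> r"
      then have "l = 0" "r = 1" using l r by auto
      then show False using l(4) r(4) e01 False by simp
    qed
    \<comment> \<open>The value at l + q is negative by antiperiodicity, so the rightward walk stops
      earlier.\<close>
    have rl': "r < l + int q"
    proof (rule ccontr)
      assume "\<not> r < l + int q"
      moreover have "l < l + int q" using q_ge_3 by simp
      ultimately have "0 < e (l + int q)"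
        using between[of "l + int q"] er by (cases "l + int q = r") auto
      then show False using eq[of l] el by simp
    qed
    \<comment> \<open>The columns of index l and l + q - 1; the signs come from
      antiperiodicity.\<close>
    define a b c d where abcd: "a = e l" "b = - e (l - 1)" "c = f l" "d = - f (l - 1)"
    have da: "dseq a b k = e (l + k)" "dseq c d k = f (l + k)" for k
      by (simp_all add: abcd ef dseq_rho)
    have idx: "tri_index a b (r - l)"
      using rl rl' between[of "r - 1"] r by (auto simp: tri_index_def da)
    have "in_tri a b"
    proof -
      have "dseq a b (int q - 1) \<le> 1"
        by (rule dseq_no_return[of a "r - l"]) (use idx rl' el in \<open>auto simp: tri_index_def abcd(1)\<close>)
      moreover have "1 < dseq a b 1"
        unfolding da using rl by (intro between) auto
      moreover have "0 < a" "a \<le> 1" using el l by (simp_all add: abcd)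
      ultimately show ?thesis by (simp add: in_tri_def)
    qed
    \<comment> \<open>Determinants of columns carry the known signs at 0 and 1 over to
      \<open>l\<close> and \<open>r\<close>.\<close>
    have cross: "e j * f k - f j * e k = sg (k - j)" for j k
      using rho_cross[of \<alpha> \<beta> j \<delta> \<kappa> k] signs(5) by (simp add: ef mult.commute)
    have "c \<le> 0"
    proof -
      have "0 \<le> sg (- l)" using l by (intro sg_nonneg) auto
      then have "f l * e 0 \<le> e l * f 0" using cross[of l 0] by simp
      also have "\<dots> \<le> 0" using el e01 signs by (simp add: mult_nonneg_nonpos)
      finally show ?thesis using e01 signs by (simp add: abcd mult_le_0_iff)
    qed
    have "0 < dseq c d (r - l)"
    proof -
      have "0 \<le> sg (r - 1)" using r by (intro sg_nonneg) auto
      then have "f 1 * e r \<le> e 1 * f r" using cross[of 1 r] by simp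
      moreover have "0 < f 1 * e r" using e01 signs er by simp
      ultimately have "0 < e 1 * f r" by linarith
      then show ?thesis using e01 signs by (simp add: da zero_less_mult_iff)
    qed
    have "m2_adj (W (1 - l)) = m2 (- sg (l - 1)) (sg (l - 2)) (sg l) (- sg (l - 1))"
      using sg_minus[of "l - 1"] sg_minus[of "l - 2"] sg_minus[of l] by (simp add: W_def m2_adj_def)
    then have "X ** m2_adj (W (1 - l)) = m2 a b c d"
      by (simp add: X abcd ef rho_def algebra_simps)
    moreover have "m2_adj (W (1 - l)) \<in> hecke_group q"
      using l by (intro hecke_group_adj W_in_group) auto
    ultimately show thesis
      using that \<open>in_tri a b\<close> idx \<open>c \<le> 0\<close> \<open>0 < dseq c d (r - l)\<close> by blast
  qed
qed

lemma coset_of_mult: "det g = 1 \<Longrightarrow> \<gamma> \<in> hecke_group q \<Longrightarrow> coset_of q (g ** \<gamma>) = coset_of q g"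
  using coset_of_eq_iff[of g "g ** \<gamma>" q] hecke_group_det by (auto simp: det_mul)

lemma SP_iff:
  "(u, v) \<in> SP q \<longleftrightarrow> crossing (Phi u v) \<and> det (Phi u v) = 1 \<and> poly_row (u $ 1) (u $ 2)"
  by (auto simp: SP_def FQFQ_def FQ_def hecke_polygon_iff crossing_def Phi_m2 poly_row_def
      inner_vec_def sum_2 algebra_simps)

lemma inj_on_SP: "inj_on (\<lambda>(u, v). coset_of q (Phi u v)) (SP q)"
proof (rule inj_onI, clarify)
  fix u v u' v' assume *: "(u, v) \<in> SP q" "(u', v') \<in> SP q" "coset_of q (Phi u v) = coset_of q (Phi u' v')"
  then obtain \<gamma> where \<gamma>: "\<gamma> \<in> hecke_group q" "Phi u' v' = Phi u v ** \<gamma>"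
    by (auto simp: SP_iff coset_of_eq_iff)
  have "Phi u v ** \<gamma> = Phi u v"
    by (rule poly_row_unique) (use * \<gamma>(1) in \<open>simp_all add: SP_iff flip: \<gamma>(2)\<close>, simp_all add: Phi_m2)
  then have "Phi u' v' = Phi u v" using \<gamma> by simp
  then show "u = u' \<and> v = v'"
    by (simp add: Phi_m2 vec_eq_iff forall_2)
qed

text \<open>By the determinant of columns 0 and \<open>i\<close>, the roof is the difference of
  their slopes. As -c/a is minus the slope of column 0, being below the roof means that column
  \<open>i\<close> has positive slope.\<close>

lemma roof_iff:
  assumes "in_tri a b" "tri_index a b i" "a * d - b * c = 1"
  shows "- c / a < sg i / (a * dseq a b i) \<longleftrightarrow> 0 < dseq c d i"
proof -
  have pos: "0 < a" "0 < dseq a b i"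
    using assms tri_index_pos by (auto simp: in_tri_def)
  have "a * dseq c d i - c * dseq a b i = sg i"
    using dseq_det[of a b 0 c d i] assms(3) by simp
  then have "- c / a < sg i / (a * dseq a b i) \<longleftrightarrow> - c * dseq a b i < a * dseq c d i - c * dseq a b i"
    using pos by (simp add: field_simps)
  also have "\<dots> \<longleftrightarrow> 0 < dseq c d i" using pos by (simp add: zero_less_mult_iff)
  finally show ?thesis .
qed

lemma h_g_upper: "h_mat s ** g_upper a b = m2 a b (- s * a) (inverse a - s * b)"
  by (simp add: h_mat_m2 g_upper_m2)

lemma SP_coset_in_suspension:
  assumes "(u, v) \<in> SP q"
  shows "coset_of q (Phi u v) \<in> suspension_coset q ` farey_suspension q"
proof -
  have SP: "crossing (Phi u v)" "det (Phi u v) = 1" "poly_row (Phi u v $ 1 $ 1) (Phi u v $ 1 $ 2)"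
    using assms by (auto simp: SP_iff Phi_m2)
  obtain \<gamma> a b c d i where *: "\<gamma> \<in> hecke_group q"
    "Phi u v ** \<gamma> = m2 a b c d" "in_tri a b" "tri_index a b i" "c \<le> 0" "0 < dseq c d i" by (rule polygon_to_suspension[OF SP])
  have a: "0 < a" using * by (simp add: in_tri_def)
  have det: "det (m2 a b c d) = 1"
    unfolding *(2)[symmetric] using SP(2) hecke_group_det[OF *(1)] by (simp add: det_mul)
  let ?u = "vector [a, b] :: real^2"
  have "(?u, - c / a) \<in> farey_suspension q"
    using * a det roof_iff[of a b i d c] farey_roof_eq[of ?u i]
    by (simp add: farey_suspension_def farey_triangle_iff divide_nonpos_pos)
  moreover have "suspension_coset q (?u, - c / a) = coset_of q (Phi u v)"
  proof -
    have "h_mat (- c / a) ** g_upper a b = m2 a b c d"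
      using a det by (simp add: h_g_upper field_simps)
    then have "suspension_coset q (?u, - c / a) = coset_of q (m2 a b c d)"
      by (simp add: suspension_coset_def)
    also have "\<dots> = coset_of q (Phi u v)"
      using coset_of_mult[OF SP(2) *(1)] *(2) by simp
    finally show ?thesis .
  qed
  ultimately show ?thesis by (intro image_eqI[where x = "(?u, - c / a)"]) simp_all
qed

lemma suspension_coset_in_SP:
  assumes "(u, s) \<in> farey_suspension q"
  shows "suspension_coset q (u, s) \<in> (\<lambda>(u, v). coset_of q (Phi u v)) ` SP q"
proof -
  define a b where ab: "a = u $ 1" "b = u $ 2"
  have tri: "in_tri a b" and s: "0 \<le> s" "s < farey_roof q u"
    using assms by (auto simp: farey_suspension_def farey_triangle_iff ab)
  obtain i where i: "tri_index a b i" using tri_index_ex[OF tri] by blast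
  have a: "0 < a" using tri by (simp add: in_tri_def)
  define c d where cd: "c = - s * a" "d = inverse a - s * b"
  have det: "a * d - b * c = 1" using a by (simp add: cd algebra_simps)
  have "c \<le> 0" using a s by (simp add: cd)
  have "s = - c / a" using a by (simp add: cd)
  then have "0 < dseq c d i"
    using s farey_roof_eq[of u i] tri i roof_iff[OF tri i det] by (simp add: ab)
  then obtain \<gamma> where \<gamma>: "\<gamma> \<in> hecke_group q" "crossing (m2 a b c d ** \<gamma>)"
    "poly_row ((m2 a b c d ** \<gamma>) $ 1 $ 1) ((m2 a b c d ** \<gamma>) $ 1 $ 2)"
    by (rule suspension_to_polygon[OF tri i det \<open>c \<le> 0\<close>])
  define X where "X = m2 a b c d ** \<gamma>"
  have detX: "det X = 1"
    using det hecke_group_det[OF \<gamma>(1)] by (simp add: X_def det_mul)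
  define v where "v = (vector [X $ 2 $ 2, - (X $ 2 $ 1)] :: real^2)"
  have Phi: "Phi (X $ 1) v = X" by (simp add: Phi_m2 v_def m2_eq_iff)
  then have "(X $ 1, v) \<in> SP q"
    using \<gamma> detX by (simp add: SP_iff flip: X_def)
  moreover have "coset_of q (Phi (X $ 1) v) = suspension_coset q (u, s)"
  proof -
    have "suspension_coset q (u, s) = coset_of q (m2 a b c d)"
      using a by (simp add: suspension_coset_def h_g_upper cd flip: ab)
    also have "\<dots> = coset_of q X"
      unfolding X_def using coset_of_mult[of "m2 a b c d", OF _ \<gamma>(1)] det by simp
    finally show ?thesis by (simp add: Phi)
  qed
  ultimately show ?thesis by (intro image_eqI[where x = "(X $ 1, v)"]) simp_all
qed

lemma bij_betw_SP:
  "bij_betw (\<lambda>(u, v). coset_of q (Phi u v)) (SP q) (suspension_coset q ` farey_suspension q)"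
proof -
  have "(\<lambda>(u, v). coset_of q (Phi u v)) ` SP q = suspension_coset q ` farey_suspension q"
    using SP_coset_in_suspension suspension_coset_in_SP by auto
  then show ?thesis using inj_on_SP by (simp add: bij_betw_def)
qed


subsection \<open>Almost every coset avoids the axes\<close>

text \<open>The parameter \<open>k\<close> is \<open>mat 1\<close> or \<open>hecke_S\<close>, for vectors on the vertical or the horizontal axis.\<close>

definition cusp_near :: "real^2^2 \<Rightarrow> real \<Rightarrow> real \<Rightarrow> (real^2^2) set set" where
  "cusp_near k \<epsilon> c = coset_of q ` {g. det g = 1 \<and> \<bar>(k ** g) $ 1 $ 1\<bar> < \<epsilon> \<and>
     c < \<bar>(k ** g) $ 2 $ 1\<bar> \<and> \<bar>(k ** g) $ 2 $ 1\<bar> < 2 * c}"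

text \<open>Arbitrary closeness to the axis, instead of a vector on it, yields a countable
  intersection of open sets, hence measurability. A vector on the axis of length strictly between
  \<open>c\<close> and 2c puts its coset in this set.\<close>

definition cusp_set :: "real^2^2 \<Rightarrow> real \<Rightarrow> (real^2^2) set set" where
  "cusp_set k c = {x. \<forall>\<epsilon>>0. x \<in> cusp_near k \<epsilon> c}"

lemma hecke_space_iff: "x \<in> hecke_space q \<longleftrightarrow> (\<exists>g. det g = 1 \<and> x = coset_of q g)"
  by (auto simp: hecke_space_def)

text \<open>The preimage in SL(2,R) is a union over the group of sets cut out by strict
  inequalities.\<close>

lemma quotient_open_cusp_near: "quotient_open q (cusp_near k \<epsilon> c)"
proof -
  let ?T = "\<Union>\<gamma>\<in>hecke_group q. {g. \<bar>(k ** (g ** \<gamma>)) $ 1 $ 1\<bar> < \<epsilon> \<and>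
     c < \<bar>(k ** (g ** \<gamma>)) $ 2 $ 1\<bar> \<and> \<bar>(k ** (g ** \<gamma>)) $ 2 $ 1\<bar> < 2 * c}"
  have "open ?T"
    unfolding matrix_mult_2_nth by (intro open_UN ballI open_Collect_conj open_Collect_less continuous_intros)
  moreover have "{g \<in> carrier SL2R. coset_of q g \<in> cusp_near k \<epsilon> c} = carrier SL2R \<inter> ?T"
  proof (intro equalityI subsetI)
    fix g assume "g \<in> {g \<in> carrier SL2R. coset_of q g \<in> cusp_near k \<epsilon> c}"
    then have g: "det g = 1" "coset_of q g \<in> cusp_near k \<epsilon> c" by auto
    then obtain h where h: "det h = 1" "coset_of q g = coset_of q h" "\<bar>(k ** h) $ 1 $ 1\<bar> < \<epsilon>"
      "c < \<bar>(k ** h) $ 2 $ 1\<bar>" "\<bar>(k ** h) $ 2 $ 1\<bar> < 2 * c"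
      by (auto simp: cusp_near_def)
    then obtain \<gamma> where "\<gamma> \<in> hecke_group q" "h = g ** \<gamma>"
      using coset_of_eq_iff[OF g(1) h(1)] by blast
    then show "g \<in> carrier SL2R \<inter> ?T" using g h by auto
  next
    fix g assume "g \<in> carrier SL2R \<inter> ?T"
    then obtain \<gamma> where *: "det g = 1" "\<gamma> \<in> hecke_group q" "\<bar>(k ** (g ** \<gamma>)) $ 1 $ 1\<bar> < \<epsilon>"
      "c < \<bar>(k ** (g ** \<gamma>)) $ 2 $ 1\<bar>" "\<bar>(k ** (g ** \<gamma>)) $ 2 $ 1\<bar> < 2 * c"
      by auto
    then have "coset_of q (g ** \<gamma>) \<in> cusp_near k \<epsilon> c"
      using hecke_group_det[OF *(2)] by (auto simp: cusp_near_def det_mul)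
    then show "g \<in> {g \<in> carrier SL2R. coset_of q g \<in> cusp_near k \<epsilon> c}"
      using * coset_of_mult[OF *(1,2)] by simp
  qed
  moreover have "cusp_near k \<epsilon> c \<subseteq> hecke_space q"
    by (auto simp: cusp_near_def hecke_space_iff)
  ultimately show ?thesis
    by (simp add: quotient_open_def openin_open_Int)
qed

lemma cusp_near_mono: "\<epsilon> \<le> \<epsilon>' \<Longrightarrow> cusp_near k \<epsilon> c \<subseteq> cusp_near k \<epsilon>' c"
  unfolding cusp_near_def by (intro image_mono) auto

lemma cusp_set_eq_INT: "cusp_set k c = (\<Inter>n. cusp_near k (inverse (real (Suc n))) c)"
proof (intro equalityI subsetI)
  fix x assume x: "x \<in> (\<Inter>n. cusp_near k (inverse (real (Suc n))) c)"
  show "x \<in> cusp_set k c"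
    unfolding cusp_set_def
  proof (intro CollectI allI impI)
    fix \<epsilon> :: real assume "0 < \<epsilon>"
    then obtain n where "inverse (real (Suc n)) < \<epsilon>" using reals_Archimedean by blast
    then show "x \<in> cusp_near k \<epsilon> c" using x cusp_near_mono[of "inverse (real (Suc n))" \<epsilon>] by force
  qed
qed (auto simp: cusp_set_def)

lemma cusp_set_sets:
  assumes "is_haar_prob q M"
  shows "cusp_set k c \<in> sets M"
proof -
  have "cusp_near k \<epsilon> c \<in> sets M" for \<epsilon>
    using assms quotient_open_cusp_near by (auto simp: is_haar_prob_def)
  then show ?thesis unfolding cusp_set_eq_INT by (intro sets.countable_INT') auto
qed

text \<open>Conjugated so that it acts on \<open>k ** g\<close> as \<open>g_mat t\<close>.\<close>

definition conj_flow :: "real^2^2 \<Rightarrow> real \<Rightarrow> real^2^2" where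
  "conj_flow k t = m2_adj k ** g_mat t ** k"

lemma conj_flow_mult:
  assumes "det k = 1"
  shows "k ** (conj_flow k t ** g) = g_mat t ** (k ** g)"
  using m2_adj_inverse[OF assms] by (simp add: conj_flow_def matrix_mul_assoc)

lemma det_conj_flow: "det k = 1 \<Longrightarrow> det (conj_flow k t) = 1"
  using m2_adj_inverse[of k] by (simp add: conj_flow_def det_mul g_mat_m2 exp_minus)

lemma conj_flow_inverse:
  assumes "det k = 1"
  shows "conj_flow k t ** conj_flow k (- t) = mat 1"
proof -
  have "conj_flow k t ** conj_flow k (- t) = m2_adj k ** g_mat t ** (k ** m2_adj k) ** g_mat (- t) ** k"
    by (simp only: conj_flow_def matrix_mul_assoc)
  also have "\<dots> = m2_adj k ** (g_mat t ** g_mat (- t)) ** k"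
    using m2_adj_inverse[OF assms] by (simp add: matrix_mul_assoc)
  also have "g_mat t ** g_mat (- t) = mat 1"
    by (simp add: g_mat_m2 mat_1_m2 flip: exp_add)
  finally show ?thesis using m2_adj_inverse[OF assms] by simp
qed

text \<open>The scaling of the first coordinate is absorbed by \<epsilon>, since every \<epsilon> is
  available; only the length window changes.\<close>

lemma cusp_set_flow:
  assumes "det k = 1" "x \<in> cusp_set k c"
  shows "conj_flow k t <#\<^bsub>SL2R\<^esub> x \<in> cusp_set k (exp (- t) * c)"
  unfolding cusp_set_def
proof (intro CollectI allI impI)
  fix \<epsilon> :: real assume "0 < \<epsilon>"
  then have "x \<in> cusp_near k (\<epsilon> * exp (- t)) c"
    using assms(2) by (simp add: cusp_set_def)
  then obtain g where g: "det g = 1" "x = coset_of q g" "\<bar>(k ** g) $ 1 $ 1\<bar> < \<epsilon> * exp (- t)"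
    "c < \<bar>(k ** g) $ 2 $ 1\<bar>" "\<bar>(k ** g) $ 2 $ 1\<bar> < 2 * c"
    by (auto simp: cusp_near_def)
  have nth: "(g_mat t ** X) $ 1 $ 1 = exp t * X $ 1 $ 1" "(g_mat t ** X) $ 2 $ 1 = exp (- t) * X $ 2 $ 1"
    for X :: "real^2^2"
    by (simp_all add: matrix_mult_2_nth g_mat_m2)
  have "exp t * \<bar>(k ** g) $ 1 $ 1\<bar> < exp t * (\<epsilon> * exp (- t))"
    using g by simp
  also have "\<dots> = \<epsilon>" by (simp add: exp_minus)
  finally have "det (conj_flow k t ** g) = 1 \<and> \<bar>(k ** (conj_flow k t ** g)) $ 1 $ 1\<bar> < \<epsilon> \<and>
      exp (- t) * c < \<bar>(k ** (conj_flow k t ** g)) $ 2 $ 1\<bar> \<and>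
      \<bar>(k ** (conj_flow k t ** g)) $ 2 $ 1\<bar> < 2 * (exp (- t) * c)"
    unfolding conj_flow_mult[OF assms(1)] nth using g det_conj_flow[OF assms(1)]
    by (simp add: det_mul abs_mult)
  then show "conj_flow k t <#\<^bsub>SL2R\<^esub> x \<in> cusp_near k \<epsilon> (exp (- t) * c)"
    unfolding g(2) l_coset_coset_of cusp_near_def by blast
qed

lemma cusp_set_image:
  assumes "det k = 1"
  shows "(\<lambda>x. conj_flow k t <#\<^bsub>SL2R\<^esub> x) ` cusp_set k c = cusp_set k (exp (- t) * c)"
proof (intro equalityI subsetI)
  fix y assume y: "y \<in> cusp_set k (exp (- t) * c)"
  then have "conj_flow k (- t) <#\<^bsub>SL2R\<^esub> y \<in> cusp_set k (exp (- (- t)) * (exp (- t) * c))"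
    by (rule cusp_set_flow[OF assms])
  moreover have "exp (- (- t)) * (exp (- t) * c) = c"
    by (simp add: exp_minus)
  ultimately have "conj_flow k (- t) <#\<^bsub>SL2R\<^esub> y \<in> cusp_set k c"
    by (simp only:)
  moreover have "y \<in> cusp_near k 1 (exp (- t) * c)"
    using y by (simp add: cusp_set_def)
  then obtain g where "y = coset_of q g" by (auto simp: cusp_near_def)
  then have "y = conj_flow k t <#\<^bsub>SL2R\<^esub> (conj_flow k (- t) <#\<^bsub>SL2R\<^esub> y)"
    by (simp add: l_coset_coset_of matrix_mul_assoc conj_flow_inverse[OF assms])
  ultimately show "y \<in> (\<lambda>x. conj_flow k t <#\<^bsub>SL2R\<^esub> x) ` cusp_set k c"
    by blast
qed (use cusp_set_flow[OF assms] in blast)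

text \<open>Two vectors of one orbit that lie close to the vertical axis are parallel, hence equal up to
  sign.\<close>

lemma cusp_set_disjoint:
  assumes "det k = 1" "0 < c" "2 * c \<le> c'"
  shows "cusp_set k c \<inter> cusp_set k c' = {}"
proof (rule ccontr)
  assume "cusp_set k c \<inter> cusp_set k c' \<noteq> {}"
  then obtain x where x: "x \<in> cusp_set k c" "x \<in> cusp_set k c'" by blast
  \<comment> \<open>With this choice the entry \<open>u\<close> of \<gamma>, a determinant of two
    nearly parallel vectors, is at most 1/2 + 1/4 in absolute value and vanishes by
    \<open>hecke_group_entries\<close>.\<close>
  define \<epsilon> where "\<epsilon> = 1 / (4 * c')"
  have \<epsilon>: "0 < \<epsilon>" "\<epsilon> * c' = 1 / 4" using assms by (auto simp: \<epsilon>_def)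
  have "x \<in> cusp_near k \<epsilon> c" "x \<in> cusp_near k \<epsilon> c'" using x \<epsilon> by (auto simp: cusp_set_def)
  then obtain g g' where g: "det g = 1" "\<bar>(k ** g) $ 1 $ 1\<bar> < \<epsilon>" "\<bar>(k ** g) $ 2 $ 1\<bar> < 2 * c"
     and g': "det g' = 1" "\<bar>(k ** g') $ 1 $ 1\<bar> < \<epsilon>" "c' < \<bar>(k ** g') $ 2 $ 1\<bar>" "\<bar>(k ** g') $ 2 $ 1\<bar> < 2 * c'"
     and "coset_of q g = coset_of q g'"
    by (auto simp: cusp_near_def)
  then obtain \<gamma> where \<gamma>: "\<gamma> \<in> hecke_group q" "g' = g ** \<gamma>"
    using coset_of_eq_iff by blast
  obtain a b s d where X: "k ** g = m2 a b s d" by (rule m2_cases)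
  obtain p r u v where G: "\<gamma> = m2 p r u v" by (rule m2_cases)
  have detX: "a * d - b * s = 1" using assms(1) g(1) X det_m2 by (metis det_mul mult_1)
  have detG: "p * v - r * u = 1" using hecke_group_det[OF \<gamma>(1)] by (simp add: G)
  have X': "k ** g' = m2 (a * p + b * u) (a * r + b * v) (s * p + d * u) (s * r + d * v)"
    by (simp add: \<gamma>(2) matrix_mul_assoc X G)
  have b1: "\<bar>a\<bar> < \<epsilon>" "\<bar>s\<bar> < 2 * c" using g by (simp_all add: X)
  have b2: "\<bar>a * p + b * u\<bar> < \<epsilon>" "c' < \<bar>s * p + d * u\<bar>" "\<bar>s * p + d * u\<bar> < 2 * c'"
    using g' by (simp_all add: X')
  have "u = (a * d - b * s) * u" by (simp add: detX)
  also have "\<dots> = a * (s * p + d * u) - s * (a * p + b * u)" by (simp add: algebra_simps)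
  finally have "\<bar>u\<bar> \<le> \<bar>a\<bar> * \<bar>s * p + d * u\<bar> + \<bar>s\<bar> * \<bar>a * p + b * u\<bar>"
    by (metis abs_mult abs_triangle_ineq4)
  also have "\<dots> \<le> \<epsilon> * (2 * c') + (2 * c) * \<epsilon>"
    using b1 b2 by (intro add_mono mult_mono) auto
  also have "\<dots> = 1 / 2 + \<epsilon> * (2 * c)" using \<epsilon> by simp
  also have "\<dots> \<le> 1 / 2 + \<epsilon> * c'" using \<epsilon> assms by (intro add_left_mono mult_left_mono) auto
  also have "\<dots> < 1" using \<epsilon> by simp
  finally have u: "u = 0" using hecke_group_entries[OF \<gamma>(1), of 2 1] by (simp add: G)
  then have "p * v = 1" using detG by simp
  then have pv: "\<bar>p\<bar> * \<bar>v\<bar> = 1" "p \<noteq> 0" "v \<noteq> 0" by (auto simp flip: abs_mult)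
  then have "1 \<le> \<bar>p\<bar>" "1 \<le> \<bar>v\<bar>"
    using hecke_group_entries[OF \<gamma>(1), of 1 1] hecke_group_entries[OF \<gamma>(1), of 2 2] by (auto simp: G)
  then have "\<bar>p\<bar> = 1" using pv(1) mult_left_mono[of 1 "\<bar>v\<bar>" "\<bar>p\<bar>"] by auto
  then have "\<bar>s * p + d * u\<bar> = \<bar>s\<bar>" by (simp add: u abs_mult)
  then show False using b1 b2 assms by simp
qed

lemma cusp_set_null:
  assumes M: "is_haar_prob q M" and k: "det k = 1" and c: "0 < c"
  shows "cusp_set k c \<in> null_sets M"
proof -
  interpret prob_space M using M by (simp add: is_haar_prob_def)
  let ?A = "\<lambda>n::nat. cusp_set k (2 ^ n * c)"
  have inv: "measure M (cusp_set k (exp (- t) * c)) = measure M (cusp_set k c)" for t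
  proof -
    have "\<forall>A\<in>sets M. emeasure M ((\<lambda>x. conj_flow k t <#\<^bsub>SL2R\<^esub> x) ` A) = emeasure M A"
      using M det_conj_flow[OF k, of t] by (auto simp: is_haar_prob_def)
    then show ?thesis
      using cusp_set_sets[OF M] cusp_set_image[OF k] by (metis measure_def)
  qed
  have eq: "measure M (?A n) = measure M (cusp_set k c)" for n
  proof -
    \<comment> \<open>The time -n ln 2 doubles the window n times, and doubling is what
      \<open>cusp_set_disjoint\<close> asks for.\<close>
    have "exp (- (- real n * ln 2)) = (2 :: real) ^ n"
      by (simp add: exp_of_nat_mult)
    then show ?thesis using inv[of "- real n * ln 2"] by simp
  qed
  have disj: "?A m \<inter> ?A n = {}" if "m < n" for m n
  proof (rule cusp_set_disjoint[OF k])
    have "(2::real) ^ Suc m \<le> 2 ^ n" using that by (intro power_increasing) auto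
    then show "2 * (2 ^ m * c) \<le> 2 ^ n * c" using c by simp
  qed (use c in simp)
  have "disjoint_family ?A"
    unfolding disjoint_family_on_def using disj by (metis Int_commute linorder_neqE_nat)
  then have "(\<lambda>n. measure M (?A n)) sums measure M (\<Union>n. ?A n)"
    using cusp_set_sets[OF M] by (intro finite_measure_UNION) auto
  then have "summable (\<lambda>n::nat. measure M (cusp_set k c))"
    unfolding eq by (rule sums_summable)
  then have "measure M (cusp_set k c) = 0" by (simp add: summable_const_iff)
  then show ?thesis
    using cusp_set_sets[OF M] by (simp add: null_sets_def emeasure_eq_measure)
qed

lemma AE_column_nonzero:
  assumes M: "is_haar_prob q M" and k: "det k = 1"
  shows "AE x in M. \<forall>g. det g = 1 \<longrightarrow> x = coset_of q g \<longrightarrow> (k ** g) $ 1 $ 1 \<noteq> 0"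
proof -
  have "AE x in M. \<forall>r\<in>\<rat> \<inter> {0<..}. x \<notin> cusp_set k r"
    using countable_rat by (subst AE_ball_countable) (auto intro: AE_not_in cusp_set_null[OF M k])
  then show ?thesis
  proof (rule AE_mp, intro AE_I2 impI allI notI)
    fix x g
    assume x: "\<forall>r\<in>\<rat> \<inter> {0<..}. x \<notin> cusp_set k r" and g: "det g = 1" "x = coset_of q g"
      and 0: "(k ** g) $ 1 $ 1 = 0"
    have "det (k ** g) = 1" using k g by (simp add: det_mul)
    then have "(k ** g) $ 2 $ 1 \<noteq> 0" using 0 by (auto simp: det_2)
    \<comment> \<open>A rational between y/2 and y puts the length y in the window (r, 2r), so
      countably many windows suffice.\<close>
    then obtain r where r: "r \<in> \<rat>" "\<bar>(k ** g) $ 2 $ 1\<bar> / 2 < r" "r < \<bar>(k ** g) $ 2 $ 1\<bar>"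
      using Rats_dense_in_real[of "\<bar>(k ** g) $ 2 $ 1\<bar> / 2" "\<bar>(k ** g) $ 2 $ 1\<bar>"] by auto
    have "0 \<le> \<bar>(k ** g) $ 2 $ 1\<bar> / 2" by simp
    then have "0 < r" using r by linarith
    moreover have "x \<in> cusp_set k r"
      using g 0 r by (auto simp: cusp_set_def cusp_near_def)
    ultimately show False using x r by blast
  qed
qed

lemma AE_axes_avoided:
  assumes "is_haar_prob q M"
  shows "AE x in M. \<forall>g. det g = 1 \<longrightarrow> x = coset_of q g \<longrightarrow> g $ 1 $ 1 \<noteq> 0 \<and> g $ 2 $ 1 \<noteq> 0"
proof -
  have "det hecke_S = 1" "det (mat 1 :: real^2^2) = 1" by (simp_all add: hecke_S_m2)
  from AE_column_nonzero[OF assms this(1)] AE_column_nonzero[OF assms this(2)]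
  show ?thesis
    by eventually_elim (auto simp: matrix_mult_2_nth hecke_S_m2)
qed

end

lemma shift_into_interval:
  fixes b c y :: real
  assumes "0 < y"
  obtains k :: int where "c < b + of_int k * y" "b + of_int k * y \<le> c + y"
proof
  define k where "k = \<lfloor>(c + y - b) / y\<rfloor>"
  have "of_int k \<le> (c + y - b) / y" "(c + y - b) / y < of_int k + 1"
    unfolding k_def by linarith+
  then have "of_int k * y \<le> c + y - b" "c + y - b < (of_int k + 1) * y"
    using assms by (simp_all add: pos_le_divide_eq pos_divide_less_eq)
  then show "c < b + of_int k * y" "b + of_int k * y \<le> c + y"
    by (simp_all add: algebra_simps)
qed

context hecke
begin

subsection \<open>Short vectors of an orbit\<close>

lemma hecke_group_T_power: "m2 1 (of_int k * lam) 0 1 \<in> hecke_group q"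
proof -
  have nat: "m2 1 (real n * lam) 0 1 \<in> hecke_group q" for n
  proof (induction n)
    case 0
    then show ?case using hecke_group_one by (simp add: mat_1_m2)
  next
    case (Suc n)
    have "m2 1 (real (Suc n) * lam) 0 1 = m2 1 (real n * lam) 0 1 ** hecke_T q"
      by (simp add: hecke_T_m2 algebra_simps)
    then show ?case using Suc hecke_group_T hecke_group_mult by simp
  qed
  show ?thesis
  proof (cases "0 \<le> k")
    case True
    then show ?thesis using nat[of "nat k"] by simp
  next
    case False
    then have "m2 1 (of_int k * lam) 0 1 = m2_adj (m2 1 (real (nat (- k)) * lam) 0 1)"
      by (simp add: m2_adj_def)
    then show ?thesis using hecke_group_adj[OF nat] by simp
  qed
qed

lemma hecke_group_lower: "m2 1 0 (of_int k * lam) 1 \<in> hecke_group q"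
proof -
  have eq: "m2 1 0 (of_int k * lam) 1 = - (hecke_S ** m2 1 (of_int (- k) * lam) 0 1 ** hecke_S)"
    by (simp add: hecke_S_m2)
  show ?thesis
    unfolding eq by (intro hecke_group_uminus hecke_group_mult hecke_group_S hecke_group_T_power)
qed

definition strip :: "real^2^2 \<Rightarrow> bool" where
  "strip X \<longleftrightarrow> 0 < X $ 1 $ 1 \<and> X $ 1 $ 1 \<le> 1"

text \<open>The time at which the horocycle flow makes the first column horizontal.\<close>

definition slope :: "real^2^2 \<Rightarrow> real" where
  "slope X = X $ 2 $ 1 / X $ 1 $ 1"

text \<open>Barycentric weights for the triangle with vertices w_0, w_(q-1), w_(q-2). For fixed
  \<open>a\<close> the admissible \<open>b\<close> fill an interval of length
  \<open>lam * a\<close>, exactly the step of right multiplication by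
  \<open>hecke_T q\<close>.\<close>

lemma poly_row_strip:
  assumes "0 < a" "a \<le> 1" "1 - a < b" "b \<le> 1 + (lam - 1) * a"
  shows "poly_row a b"
proof -
  have "rho a b k - rho a b (k + 1) \<le> 1" for k
  proof -
    define A B where AB: "A = sg k - sg (k - 1)" "B = sg k - sg (k + 1)"
    have "A + lam * B = sg (k + 1) - sg (k + 1 + 1)"
      using sg_rec[of k] sg_rec[of "k + 1"] by (simp add: AB algebra_simps)
    then have AB1: "A \<le> 1" "B \<le> 1" "A + lam * B \<le> 1"
      using sg_steps[of k] sg_steps(2)[of "k + 1"] by (auto simp: AB)
    have "lam * (a * A + b * B) = (lam * (1 - a)) * B + (lam * a - (b - 1 + a)) * A + (b - 1 + a) * (A + lam * B)"
      by (simp add: algebra_simps)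
    also have "\<dots> \<le> (lam * (1 - a)) * 1 + (lam * a - (b - 1 + a)) * 1 + (b - 1 + a) * 1"
    proof (intro add_mono mult_left_mono)
      show "0 \<le> lam * a - (b - 1 + a)" using assms by (simp add: algebra_simps)
    qed (use assms AB1 lam_ge_1 in auto)
    also have "\<dots> = lam * 1" by (simp add: algebra_simps)
    finally have "a * A + b * B \<le> 1"
      using lam_ge_1 by (auto intro: mult_left_le_imp_le[of lam "a * A + b * B" 1])
    then show ?thesis unfolding rho_gap AB .
  qed
  then show ?thesis using assms by (simp add: poly_row_def)
qed

lemma strip_shift:
  assumes "strip X"
  obtains \<gamma> b d where "\<gamma> \<in> hecke_group q" "X ** \<gamma> = m2 (X $ 1 $ 1) b (X $ 2 $ 1) d"
    "e < b" "b \<le> e + lam * X $ 1 $ 1"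
proof -
  have "0 < lam * X $ 1 $ 1" using assms lam_ge_1 by (simp add: strip_def)
  then obtain k where k: "e < X $ 1 $ 2 + of_int k * (lam * X $ 1 $ 1)"
    "X $ 1 $ 2 + of_int k * (lam * X $ 1 $ 1) \<le> e + lam * X $ 1 $ 1"
    by (rule shift_into_interval)
  show thesis
  proof (rule that[OF hecke_group_T_power])
    show "X ** m2 1 (of_int k * lam) 0 1 = m2 (X $ 1 $ 1) (X $ 1 $ 2 + of_int k * (lam * X $ 1 $ 1))
       (X $ 2 $ 1) (X $ 2 $ 2 + of_int k * (lam * X $ 2 $ 1))"
      by (simp add: m2_eq_iff matrix_mult_2_nth)
  qed (use k in auto)
qed

lemma strip_polygon:
  assumes "strip X"
  obtains \<gamma> where "\<gamma> \<in> hecke_group q" "poly_row ((X ** \<gamma>) $ 1 $ 1) ((X ** \<gamma>) $ 1 $ 2)"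
    "slope (X ** \<gamma>) = slope X"
proof -
  obtain \<gamma> b d where *: "\<gamma> \<in> hecke_group q" "X ** \<gamma> = m2 (X $ 1 $ 1) b (X $ 2 $ 1) d"
    "1 - X $ 1 $ 1 < b" "b \<le> 1 - X $ 1 $ 1 + lam * X $ 1 $ 1"
    using strip_shift[OF assms] by blast
  then show thesis
    using that[of \<gamma>] assms poly_row_strip[of "X $ 1 $ 1" b]
    by (simp add: strip_def slope_def algebra_simps)
qed

text \<open>The slope gap is \<open>sg i / (a * dseq a b i)\<close>, with numerator at least 1 and
  denominator at most 1. The sign \<sigma> covers both orientations.\<close>

lemma strip_neighbour:
  assumes "in_tri a b" "tri_index a b i" "a * d - b * c = \<sigma>" "\<bar>\<sigma>\<bar> = 1"
  shows "dseq a b i \<le> 1" "0 < dseq a b i" "1 \<le> \<sigma> * (dseq c d i / dseq a b i - c / a)"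
proof -
  have a: "0 < a" "a \<le> 1" using assms by (auto simp: in_tri_def)
  show d: "dseq a b i \<le> 1" "0 < dseq a b i"
    using assms tri_index_pos by (auto simp: tri_index_def)
  have s: "1 \<le> sg i" using assms by (intro sg_ge_1) (auto simp: tri_index_def)
  have "a * dseq c d i - c * dseq a b i = \<sigma> * sg i"
    using dseq_det[of a b 0 c d i] assms(3) by simp
  then have "dseq c d i / dseq a b i - c / a = \<sigma> * sg i / (a * dseq a b i)"
    using a d by (simp add: field_simps)
  moreover have "\<sigma> * \<sigma> = 1" using assms(4) by (metis abs_mult_self_eq mult_1)
  ultimately have "\<sigma> * (dseq c d i / dseq a b i - c / a) = sg i / (a * dseq a b i)"
    by (simp flip: mult.assoc)
  moreover have "a * dseq a b i \<le> 1" using a d by (intro mult_le_one) auto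
  then have "1 \<le> sg i / (a * dseq a b i)" using a d s by (simp add: pos_le_divide_eq)
  ultimately show "1 \<le> \<sigma> * (dseq c d i / dseq a b i - c / a)" by simp
qed

lemma strip_tri:
  assumes "strip X" "det X = 1"
  obtains \<gamma> a b c d i where "\<gamma> \<in> hecke_group q" "X ** \<gamma> = m2 a b c d" "in_tri a b" "tri_index a b i"
    "a * d - b * c = 1" "slope X = c / a"
proof -
  obtain \<gamma> b d where *: "\<gamma> \<in> hecke_group q" "X ** \<gamma> = m2 (X $ 1 $ 1) b (X $ 2 $ 1) d"
    "1 - lam * X $ 1 $ 1 < b" "b \<le> 1 - lam * X $ 1 $ 1 + lam * X $ 1 $ 1"
    using strip_shift[OF assms(1)] by blast
  then have tri: "in_tri (X $ 1 $ 1) b" using assms(1) by (simp add: in_tri_def strip_def)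
  have "det (X ** \<gamma>) = 1" using assms(2) hecke_group_det[OF *(1)] by (simp add: det_mul)
  then have "X $ 1 $ 1 * d - b * X $ 2 $ 1 = 1" by (simp add: *(2))
  moreover obtain i where "tri_index (X $ 1 $ 1) b i" using tri_index_ex[OF tri] .
  ultimately show thesis
    using that[OF *(1,2) tri] by (simp add: slope_def)
qed

lemma dseq_W: "m2 a b c d ** W (j + 1) = m2 (dseq a b j) (dseq a b (j + 1)) (dseq c d j) (dseq c d (j + 1))"
  by (simp add: W_def dseq_def add.commute)

lemma strip_up:
  assumes "strip X" "det X = 1"
  obtains \<gamma> where "\<gamma> \<in> hecke_group q" "strip (X ** \<gamma>)" "slope X + 1 \<le> slope (X ** \<gamma>)"
proof -
  obtain \<gamma> a b c d i where *: "\<gamma> \<in> hecke_group q" "X ** \<gamma> = m2 a b c d" "in_tri a b" "tri_index a b i"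
    "a * d - b * c = 1" "slope X = c / a"
    by (rule strip_tri[OF assms])
  have "X ** (\<gamma> ** W (i + 1)) = m2 (dseq a b i) (dseq a b (i + 1)) (dseq c d i) (dseq c d (i + 1))"
    by (simp add: matrix_mul_assoc *(2) dseq_W)
  moreover have "\<gamma> ** W (i + 1) \<in> hecke_group q"
    using * by (intro hecke_group_mult W_in_group) (auto simp: tri_index_def)
  ultimately show thesis
    using that strip_neighbour[OF *(3,4,5)] *(6) by (simp add: strip_def slope_def)
qed

text \<open>Negating the second column gives determinant -1, and then \<open>strip_neighbour\<close>
  lowers the slope. Swapping columns restores determinant 1, so the neighbour is reached by a group
  element.\<close>

lemma strip_down:
  assumes "strip X" "det X = 1"
  obtains \<gamma> where "\<gamma> \<in> hecke_group q" "strip (X ** \<gamma>)" "slope (X ** \<gamma>) \<le> slope X - 1"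
proof -
  obtain p r s v where X: "X = m2 p r s v" by (rule m2_cases)
  have p: "0 < p" "p \<le> 1" and det: "p * v - r * s = 1"
    using assms by (auto simp: X strip_def)
  have "0 < lam * p" using p lam_ge_1 by simp
  then obtain k where k: "1 - lam * p < - r + of_int k * (lam * p)" "- r + of_int k * (lam * p) \<le> 1 - lam * p + lam * p"
    by (rule shift_into_interval)
  define c e where ce: "c = - r + of_int k * (lam * p)" "e = - v + of_int k * (lam * s)"
  have tri: "in_tri p c" using k p by (simp add: in_tri_def ce)
  obtain i where i: "tri_index p c i" using tri_index_ex[OF tri] .
  have det': "p * e - c * s = - 1" using det by (simp add: ce algebra_simps)
  define \<gamma> where "\<gamma> = - (hecke_S ** m2 1 0 (of_int k * lam) 1) ** W (int q - i)"
  have "\<gamma> \<in> hecke_group q"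
    unfolding \<gamma>_def using i
    by (intro hecke_group_mult hecke_group_uminus hecke_group_S hecke_group_lower W_in_group)
      (auto simp: tri_index_def)
  moreover have "X ** (- (hecke_S ** m2 1 0 (of_int k * lam) 1)) = m2 c p e s"
    by (simp add: X ce hecke_S_m2 algebra_simps)
  then have eq: "X ** \<gamma> = m2 c p e s ** W (int q - i)"
    unfolding \<gamma>_def by (simp only: matrix_mul_assoc)
  have "sg (int q - i) = sg i" "sg (int q - i - 1) = sg (i + 1)"
    using sg_diff_q[of i] sg_diff_q[of "i + 1"] by (simp_all add: algebra_simps)
  then have "(X ** \<gamma>) $ 1 $ 1 = dseq p c i" "(X ** \<gamma>) $ 2 $ 1 = dseq s e i"
    unfolding eq by (simp_all add: W_def dseq_def)
  ultimately show thesis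
    using that[of \<gamma>] strip_neighbour[OF tri i det'] by (simp add: strip_def slope_def X)
qed

text \<open>A Euclidean algorithm: reducing the second entry to its nearest remainder modulo
  \<open>lam * a\<close> and exchanging columns shrinks the first entry by the factor
  \<open>lam / 2\<close> < 1 or better.\<close>

lemma strip_exists:
  assumes "\<And>\<gamma>. \<gamma> \<in> hecke_group q \<Longrightarrow> (g ** \<gamma>) $ 1 $ 1 \<noteq> 0"
  obtains \<gamma> where "\<gamma> \<in> hecke_group q" "strip (g ** \<gamma>)"
proof -
  have shrink: "\<exists>\<gamma>\<in>hecke_group q. \<bar>(g ** \<gamma>) $ 1 $ 1\<bar> \<le> (lam / 2) ^ n * \<bar>g $ 1 $ 1\<bar>" for n
  proof (induction n)
    case 0
    then show ?case using hecke_group_one by (intro bexI[of _ "mat 1"]) auto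
  next
    case (Suc n)
    then obtain \<gamma> where \<gamma>: "\<gamma> \<in> hecke_group q" "\<bar>(g ** \<gamma>) $ 1 $ 1\<bar> \<le> (lam / 2) ^ n * \<bar>g $ 1 $ 1\<bar>" by blast
    define a b where ab: "a = (g ** \<gamma>) $ 1 $ 1" "b = (g ** \<gamma>) $ 1 $ 2"
    have a: "a \<noteq> 0" using assms \<gamma> by (simp add: ab)
    define k where "k = round (b / (lam * a))"
    define \<delta> where "\<delta> = m2 1 (of_int (- k) * lam) 0 1 ** hecke_S"
    have "(g ** \<gamma> ** \<delta>) $ 1 $ 1 = b - of_int k * (lam * a)"
      unfolding \<delta>_def by (simp add: hecke_S_m2 matrix_mult_2_nth[of "g ** \<gamma>"] ab)
    also have "\<bar>\<dots>\<bar> = \<bar>of_int k - b / (lam * a)\<bar> * \<bar>lam * a\<bar>"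
      using a lam_ge_1 by (simp add: abs_mult[symmetric] field_simps)
    also have "\<dots> \<le> 1 / 2 * \<bar>lam * a\<bar>"
      unfolding k_def by (intro mult_right_mono of_int_round_abs_le) auto
    also have "\<dots> = lam / 2 * \<bar>a\<bar>" using lam_ge_1 by (simp add: abs_mult)
    also have "\<dots> \<le> lam / 2 * ((lam / 2) ^ n * \<bar>g $ 1 $ 1\<bar>)"
      using \<gamma> lam_ge_1 unfolding ab by (intro mult_left_mono) auto
    finally have "\<bar>(g ** (\<gamma> ** \<delta>)) $ 1 $ 1\<bar> \<le> (lam / 2) ^ Suc n * \<bar>g $ 1 $ 1\<bar>"
      by (simp add: matrix_mul_assoc)
    moreover have "\<gamma> ** \<delta> \<in> hecke_group q"
      unfolding \<delta>_def by (intro hecke_group_mult \<gamma> hecke_group_S hecke_group_T_power)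
    ultimately show ?case by blast
  qed
  have g: "0 < \<bar>g $ 1 $ 1\<bar>" using assms[OF hecke_group_one] by simp
  obtain n where "(lam / 2) ^ n < 1 / \<bar>g $ 1 $ 1\<bar>"
    using real_arch_pow_inv[of "1 / \<bar>g $ 1 $ 1\<bar>" "lam / 2"] g lam_less_2 by auto
  then have "(lam / 2) ^ n * \<bar>g $ 1 $ 1\<bar> \<le> 1"
    using g by (simp add: pos_less_divide_eq less_imp_le)
  then obtain \<gamma> where \<gamma>: "\<gamma> \<in> hecke_group q" "\<bar>(g ** \<gamma>) $ 1 $ 1\<bar> \<le> 1"
    using shrink[of n] by force
  show thesis
  proof (cases "0 < (g ** \<gamma>) $ 1 $ 1")
    case True
    then show thesis using that[OF \<gamma>(1)] \<gamma>(2) by (simp add: strip_def)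
  next
    case False
    then show thesis
      using that[OF hecke_group_uminus[OF \<gamma>(1)]] \<gamma>(2) assms[OF \<gamma>(1)] by (simp add: strip_def)
  qed
qed

lemma strip_slopes:
  assumes "det g = 1" "\<And>\<gamma>. \<gamma> \<in> hecke_group q \<Longrightarrow> (g ** \<gamma>) $ 1 $ 1 \<noteq> 0"
  shows "\<exists>\<gamma>\<in>hecke_group q. strip (g ** \<gamma>) \<and> B \<le> slope (g ** \<gamma>)"
    and "\<exists>\<gamma>\<in>hecke_group q. strip (g ** \<gamma>) \<and> slope (g ** \<gamma>) \<le> B"
proof -
  obtain \<gamma>0 where \<gamma>0: "\<gamma>0 \<in> hecke_group q" "strip (g ** \<gamma>0)"
    using strip_exists[OF assms(2)] .
  have det: "det (g ** \<gamma>) = 1" if "\<gamma> \<in> hecke_group q" for \<gamma>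
    using that assms(1) hecke_group_det by (simp add: det_mul)
  have up: "\<exists>\<gamma>\<in>hecke_group q. strip (g ** \<gamma>) \<and> slope (g ** \<gamma>0) + real n \<le> slope (g ** \<gamma>)" for n
  proof (induction n)
    case (Suc n)
    then obtain \<gamma> where \<gamma>: "\<gamma> \<in> hecke_group q" "strip (g ** \<gamma>)" "slope (g ** \<gamma>0) + real n \<le> slope (g ** \<gamma>)"
      by blast
    obtain \<delta> where \<delta>: "\<delta> \<in> hecke_group q" "strip (g ** \<gamma> ** \<delta>)" "slope (g ** \<gamma>) + 1 \<le> slope (g ** \<gamma> ** \<delta>)"
      by (rule strip_up[OF \<gamma>(2) det[OF \<gamma>(1)]])
    show ?case
      using \<gamma> \<delta> hecke_group_mult by (intro bexI[of _ "\<gamma> ** \<delta>"]) (auto simp: matrix_mul_assoc)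
  qed (use \<gamma>0 in auto)
  have down: "\<exists>\<gamma>\<in>hecke_group q. strip (g ** \<gamma>) \<and> slope (g ** \<gamma>) \<le> slope (g ** \<gamma>0) - real n" for n
  proof (induction n)
    case (Suc n)
    then obtain \<gamma> where \<gamma>: "\<gamma> \<in> hecke_group q" "strip (g ** \<gamma>)" "slope (g ** \<gamma>) \<le> slope (g ** \<gamma>0) - real n"
      by blast
    obtain \<delta> where \<delta>: "\<delta> \<in> hecke_group q" "strip (g ** \<gamma> ** \<delta>)" "slope (g ** \<gamma> ** \<delta>) \<le> slope (g ** \<gamma>) - 1"
      by (rule strip_down[OF \<gamma>(2) det[OF \<gamma>(1)]])
    show ?case
      using \<gamma> \<delta> hecke_group_mult by (intro bexI[of _ "\<gamma> ** \<delta>"]) (auto simp: matrix_mul_assoc)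
  qed (use \<gamma>0 in auto)
  obtain n where "\<bar>slope (g ** \<gamma>0)\<bar> + \<bar>B\<bar> \<le> real n" using real_arch_simple by blast
  then show "\<exists>\<gamma>\<in>hecke_group q. strip (g ** \<gamma>) \<and> B \<le> slope (g ** \<gamma>)"
    "\<exists>\<gamma>\<in>hecke_group q. strip (g ** \<gamma>) \<and> slope (g ** \<gamma>) \<le> B"
    using up[of n] down[of n] by fastforce+
qed

text \<open>Either the next strip vector still has slope \<le> 0, or the sign change occurs within
  the common polygon and gives a crossed side. Each of its two entries is at most 2/(2 -
  \<open>lam\<close>).\<close>

lemma small_crossing_step:
  assumes "strip X" "det X = 1" "slope X \<le> 0"
  shows "(\<exists>\<gamma>\<in>hecke_group q. crossing (X ** \<gamma>) \<and> rowsum (X ** \<gamma>) \<le> 4 / (2 - lam)) \<or>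
    (\<exists>\<gamma>\<in>hecke_group q. strip (X ** \<gamma>) \<and> slope (X ** \<gamma>) \<le> 0 \<and> slope X + 1 \<le> slope (X ** \<gamma>))"
proof -
  obtain \<gamma> a b c d i where *: "\<gamma> \<in> hecke_group q" "X ** \<gamma> = m2 a b c d" "in_tri a b" "tri_index a b i"
    "a * d - b * c = 1" "slope X = c / a"
    by (rule strip_tri[OF assms(1,2)])
  have a: "0 < a" "a \<le> 1" "b \<le> 1" using *(3) by (auto simp: in_tri_def)
  have i: "2 \<le> i" "i < int q" using *(4) by (auto simp: tri_index_def)
  have eq: "X ** (\<gamma> ** W (j + 1)) = m2 (dseq a b j) (dseq a b (j + 1)) (dseq c d j) (dseq c d (j + 1))" for j
    by (simp add: matrix_mul_assoc *(2) dseq_W)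
  have G: "\<gamma> ** W (j + 1) \<in> hecke_group q" if "0 \<le> j" for j
    using that *(1) by (intro hecke_group_mult W_in_group) auto
  have c: "c \<le> 0" using assms(3) a *(6) by (simp add: divide_le_0_iff)
  show ?thesis
  proof (cases "dseq c d i \<le> 0")
    case True
    then show ?thesis
      using G[of i] i strip_neighbour[OF *(3,4,5)] *(6)
      by (intro disjI2 bexI[of _ "\<gamma> ** W (i + 1)"])
        (auto simp: eq strip_def slope_def divide_le_0_iff)
  next
    case False
    obtain j where j: "0 \<le> j" "j < i" "dseq c d j \<le> 0" "\<not> dseq c d (j + 1) \<le> 0"
      using int_switch[of "\<lambda>k. dseq c d k \<le> 0" 0 i] c False i by auto
    have pos: "0 < dseq a b k" if "0 \<le> k" "k \<le> i" for k
      using that tri_index_below[OF *(3,4), of k] tri_index_pos[OF *(3,4)] a by (cases "k = 0 \<or> k = i") auto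
    have bound: "dseq a b k \<le> 2 / (2 - lam)" if "0 \<le> k" "k \<le> i" for k
    proof -
      have "sg n \<le> 1 / (2 - lam)" for n
        using sg_small[of n] lam_less_2 by (simp add: pos_le_divide_eq mult.commute)
      from this[of k] this[of "k + 1"] have "sg (k + 1) + sg k \<le> 2 / (2 - lam)" by simp
      moreover have "a * sg (k + 1) \<le> 1 * sg (k + 1)" "b * sg k \<le> 1 * sg k"
        using a that i by (intro mult_right_mono sg_nonneg; simp)+
      ultimately show ?thesis unfolding dseq_def by linarith
    qed
    have "dseq a b j + dseq a b (j + 1) \<le> 4 / (2 - lam)"
      using bound[of j] bound[of "j + 1"] j by simp
    then show ?thesis
      using G[of j] j pos[of j] pos[of "j + 1"]
      by (intro disjI1 bexI[of _ "\<gamma> ** W (j + 1)"]) (auto simp: eq crossing_def rowsum_def)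
  qed
qed

text \<open>Each step up the strip raises the slope by at least 1, so it cannot stay \<le> 0. The
  bound is independent of \<open>g\<close> and so applies all along a geodesic.\<close>

lemma small_crossing:
  assumes "det g = 1" "\<And>\<gamma>. \<gamma> \<in> hecke_group q \<Longrightarrow> (g ** \<gamma>) $ 1 $ 1 \<noteq> 0"
  shows "\<exists>\<gamma>\<in>hecke_group q. crossing (g ** \<gamma>) \<and> rowsum (g ** \<gamma>) \<le> 4 / (2 - lam)"
proof (rule ccontr)
  assume no: "\<not> ?thesis"
  obtain \<gamma>0 where \<gamma>0: "\<gamma>0 \<in> hecke_group q" "strip (g ** \<gamma>0)" "slope (g ** \<gamma>0) \<le> 0"
    using strip_slopes(2)[OF assms, of 0] by blast
  have "\<exists>\<gamma>\<in>hecke_group q. strip (g ** \<gamma>) \<and> slope (g ** \<gamma>) \<le> 0 \<and> slope (g ** \<gamma>0) + real n \<le> slope (g ** \<gamma>)" for n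
  proof (induction n)
    case (Suc n)
    then obtain \<gamma> where \<gamma>: "\<gamma> \<in> hecke_group q" "strip (g ** \<gamma>)" "slope (g ** \<gamma>) \<le> 0"
      "slope (g ** \<gamma>0) + real n \<le> slope (g ** \<gamma>)" by blast
    have "det (g ** \<gamma>) = 1" using assms(1) hecke_group_det[OF \<gamma>(1)] by (simp add: det_mul)
    from small_crossing_step[OF \<gamma>(2) this \<gamma>(3)] show ?case
    proof
      assume "\<exists>\<delta>\<in>hecke_group q. crossing (g ** \<gamma> ** \<delta>) \<and> rowsum (g ** \<gamma> ** \<delta>) \<le> 4 / (2 - lam)"
      then obtain \<delta> where "\<delta> \<in> hecke_group q" "crossing (g ** (\<gamma> ** \<delta>)) \<and> rowsum (g ** (\<gamma> ** \<delta>)) \<le> 4 / (2 - lam)"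
        by (auto simp: matrix_mul_assoc)
      then show ?thesis using no hecke_group_mult[OF \<gamma>(1)] by blast
    next
      assume "\<exists>\<delta>\<in>hecke_group q. strip (g ** \<gamma> ** \<delta>) \<and> slope (g ** \<gamma> ** \<delta>) \<le> 0 \<and>
        slope (g ** \<gamma>) + 1 \<le> slope (g ** \<gamma> ** \<delta>)"
      then obtain \<delta> where \<delta>: "\<delta> \<in> hecke_group q" "strip (g ** \<gamma> ** \<delta>)" "slope (g ** \<gamma> ** \<delta>) \<le> 0"
        "slope (g ** \<gamma>) + 1 \<le> slope (g ** \<gamma> ** \<delta>)" by blast
      then show ?thesis
        using \<gamma> hecke_group_mult by (intro bexI[of _ "\<gamma> ** \<delta>"]) (auto simp: matrix_mul_assoc)
    qed
  qed (use \<gamma>0 in auto)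
  moreover obtain n where "1 - slope (g ** \<gamma>0) \<le> real n" using real_arch_simple by blast
  ultimately obtain \<gamma> where "slope (g ** \<gamma>) \<le> 0" "slope (g ** \<gamma>0) + real n \<le> slope (g ** \<gamma>)"
    by blast
  with \<open>1 - slope (g ** \<gamma>0) \<le> real n\<close> show False by linarith
qed


subsection \<open>The horocycle flow\<close>

definition polygon_section :: "(real^2^2) set set" where
  "polygon_section = {coset_of q (g_upper (u $ 1) (u $ 2)) | u. u \<in> hecke_polygon q}"

lemma horocycle_flow_coset: "horocycle_flow t (coset_of q g) = coset_of q (h_mat t ** g)"
  by (simp add: horocycle_flow_def l_coset_coset_of)

lemma polygon_section_subset: "polygon_section \<subseteq> hecke_space q"
  by (force simp: polygon_section_def hecke_space_iff g_upper_m2 hecke_polygon_iff poly_row_def)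

lemma horocycle_returns:
  assumes g: "det g = 1"
  shows "{t. horocycle_flow t (coset_of q g) \<in> polygon_section} =
    {slope (g ** \<gamma>) | \<gamma>. \<gamma> \<in> hecke_group q \<and> poly_row ((g ** \<gamma>) $ 1 $ 1) ((g ** \<gamma>) $ 1 $ 2)}"
proof (intro equalityI subsetI)
  fix t assume "t \<in> {t. horocycle_flow t (coset_of q g) \<in> polygon_section}"
  then obtain u :: "real^2" where u: "poly_row (u $ 1) (u $ 2)"
    "coset_of q (h_mat t ** g) = coset_of q (g_upper (u $ 1) (u $ 2))"
    by (auto simp: horocycle_flow_coset polygon_section_def hecke_polygon_iff)
  have "0 < u $ 1" using u by (simp add: poly_row_def)
  then have "det (h_mat t ** g) = 1" "det (g_upper (u $ 1) (u $ 2)) = 1"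
    using g by (simp_all add: det_mul h_mat_m2 g_upper_m2)
  then obtain \<gamma> where \<gamma>: "\<gamma> \<in> hecke_group q" "g_upper (u $ 1) (u $ 2) = h_mat t ** (g ** \<gamma>)"
    using u(2) by (auto simp: coset_of_eq_iff matrix_mul_assoc)
  obtain a b c d where X: "g ** \<gamma> = m2 a b c d" by (rule m2_cases)
  have "u $ 1 = a" "u $ 2 = b" "c = t * a"
    using \<gamma>(2) by (simp_all add: X h_mat_m2 g_upper_m2)
  then have "poly_row ((g ** \<gamma>) $ 1 $ 1) ((g ** \<gamma>) $ 1 $ 2)" "t = slope (g ** \<gamma>)"
    using u(1) \<open>0 < u $ 1\<close> by (simp_all add: X slope_def)
  then show "t \<in> {slope (g ** \<gamma>) | \<gamma>. \<gamma> \<in> hecke_group q \<and> poly_row ((g ** \<gamma>) $ 1 $ 1) ((g ** \<gamma>) $ 1 $ 2)}"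
    using \<gamma>(1) by blast
next
  fix t assume "t \<in> {slope (g ** \<gamma>) | \<gamma>. \<gamma> \<in> hecke_group q \<and> poly_row ((g ** \<gamma>) $ 1 $ 1) ((g ** \<gamma>) $ 1 $ 2)}"
  then obtain \<gamma> where \<gamma>: "\<gamma> \<in> hecke_group q" "poly_row ((g ** \<gamma>) $ 1 $ 1) ((g ** \<gamma>) $ 1 $ 2)" "t = slope (g ** \<gamma>)"
    by blast
  obtain a b c d where X: "g ** \<gamma> = m2 a b c d" by (rule m2_cases)
  have "det (g ** \<gamma>) = 1" using g hecke_group_det[OF \<gamma>(1)] by (simp add: det_mul)
  then have det: "a * d - b * c = 1" by (simp add: X)
  have a: "0 < a" using \<gamma>(2) by (simp add: X poly_row_def)
  have "h_mat t ** (g ** \<gamma>) = g_upper a b"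
    using a det by (simp add: X h_mat_m2 g_upper_m2 \<gamma>(3) slope_def field_simps)
  then have "horocycle_flow t (coset_of q g) = coset_of q (g_upper a b)"
    using coset_of_mult[OF g \<gamma>(1)] by (metis horocycle_flow_coset)
  moreover have "(vector [a, b] :: real^2) \<in> hecke_polygon q"
    using \<gamma>(2) by (simp add: hecke_polygon_iff X)
  ultimately show "t \<in> {t. horocycle_flow t (coset_of q g) \<in> polygon_section}"
    unfolding polygon_section_def by force
qed

text \<open>The difference of two return times, multiplied by the two first entries, is an entry of
  a group element: 0 or at least 1 in absolute value. By \<open>poly_row_bound\<close> distinct
  times are (2 - \<open>lam\<close>)^2 apart.\<close>

lemma horocycle_returns_discrete:
  assumes g: "det g = 1"
  shows "discrete {t. horocycle_flow t (coset_of q g) \<in> polygon_section}"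
  unfolding horocycle_returns[OF g]
proof (rule discreteI)
  let ?S = "{slope (g ** \<gamma>) | \<gamma>. \<gamma> \<in> hecke_group q \<and> poly_row ((g ** \<gamma>) $ 1 $ 1) ((g ** \<gamma>) $ 1 $ 2)}"
  fix x assume x: "x \<in> ?S"
  have "y = x" if y: "y \<in> ?S" and dist: "dist x y < (2 - lam)\<^sup>2" for y
  proof -
    from x y obtain \<gamma> \<delta> where
      \<gamma>: "\<gamma> \<in> hecke_group q" "poly_row ((g ** \<gamma>) $ 1 $ 1) ((g ** \<gamma>) $ 1 $ 2)" "x = slope (g ** \<gamma>)" and
      \<delta>: "\<delta> \<in> hecke_group q" "poly_row ((g ** \<delta>) $ 1 $ 1) ((g ** \<delta>) $ 1 $ 2)" "y = slope (g ** \<delta>)"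
      by auto
    obtain a b c d where X: "g ** \<gamma> = m2 a b c d" by (rule m2_cases)
    obtain p r s v where Y: "g ** \<delta> = m2 p r s v" by (rule m2_cases)
    have pos: "0 < a" "0 < p" "a \<le> 1 / (2 - lam)" "p \<le> 1 / (2 - lam)"
      using \<gamma>(2) \<delta>(2) poly_row_bound by (auto simp: X Y poly_row_def)
    have detX: "det (g ** \<gamma>) = 1" using g hecke_group_det[OF \<gamma>(1)] by (simp add: det_mul)
    have "m2_adj (g ** \<gamma>) ** (g ** \<delta>) = m2_adj \<gamma> ** \<delta>"
    proof -
      have "m2_adj \<gamma> ** \<delta> = (m2_adj (g ** \<gamma>) ** (g ** \<gamma>)) ** (m2_adj \<gamma> ** \<delta>)"
        using m2_adj_inverse[OF detX] by simp
      also have "\<dots> = m2_adj (g ** \<gamma>) ** g ** (\<gamma> ** m2_adj \<gamma>) ** \<delta>"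
        by (simp only: matrix_mul_assoc)
      also have "\<dots> = m2_adj (g ** \<gamma>) ** (g ** \<delta>)"
        using m2_adj_inverse[OF hecke_group_det[OF \<gamma>(1)]] by (simp add: matrix_mul_assoc)
      finally show ?thesis by simp
    qed
    then have "m2_adj (g ** \<gamma>) ** (g ** \<delta>) \<in> hecke_group q"
      using \<gamma>(1) \<delta>(1) hecke_group_mult hecke_group_adj by simp
    from hecke_group_entries[OF this, of 2 1] have ent: "a * s - c * p = 0 \<or> 1 \<le> \<bar>a * s - c * p\<bar>"
      by (simp add: X Y m2_adj_def)
    have yx: "(y - x) * (a * p) = a * s - c * p"
      using pos by (simp add: \<gamma>(3) \<delta>(3) X Y slope_def field_simps)
    have "\<bar>y - x\<bar> * (a * p) \<le> \<bar>y - x\<bar> * (1 / (2 - lam) * (1 / (2 - lam)))"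
      using pos lam_less_2 by (intro mult_left_mono mult_mono) auto
    also have "\<dots> < 1"
      using dist lam_less_2 by (simp add: dist_real_def power2_eq_square pos_divide_less_eq abs_minus_commute)
    finally have "\<bar>(y - x) * (a * p)\<bar> < 1"
      using pos by (simp add: abs_mult)
    then have "(y - x) * (a * p) = 0" using ent by (simp add: yx)
    then show "y = x" using pos by simp
  qed
  then show "x isolated_in ?S"
    unfolding isolated_in_dist_Ex_iff using x lam_less_2 by (intro conjI exI[of _ "(2 - lam)\<^sup>2"]) auto
qed

lemma horocycle_returns_unbounded:
  assumes g: "det g = 1" and nz: "\<And>\<gamma>. \<gamma> \<in> hecke_group q \<Longrightarrow> (g ** \<gamma>) $ 1 $ 1 \<noteq> 0"
  shows "\<not> bdd_above {t. horocycle_flow t (coset_of q g) \<in> polygon_section}"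
    and "\<not> bdd_below {t. horocycle_flow t (coset_of q g) \<in> polygon_section}"
proof -
  let ?S = "{t. horocycle_flow t (coset_of q g) \<in> polygon_section}"
  have ret: "slope (g ** \<gamma>) \<in> ?S" if \<gamma>: "\<gamma> \<in> hecke_group q" "strip (g ** \<gamma>)" for \<gamma>
  proof -
    obtain \<delta> where \<delta>: "\<delta> \<in> hecke_group q" "poly_row ((g ** \<gamma> ** \<delta>) $ 1 $ 1) ((g ** \<gamma> ** \<delta>) $ 1 $ 2)"
      "slope (g ** \<gamma> ** \<delta>) = slope (g ** \<gamma>)"
      by (rule strip_polygon[OF \<gamma>(2)])
    then have "poly_row ((g ** (\<gamma> ** \<delta>)) $ 1 $ 1) ((g ** (\<gamma> ** \<delta>)) $ 1 $ 2)"
      "slope (g ** \<gamma>) = slope (g ** (\<gamma> ** \<delta>))"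
      by (simp_all add: matrix_mul_assoc)
    then show ?thesis
      unfolding horocycle_returns[OF g] using hecke_group_mult[OF \<gamma>(1) \<delta>(1)] by blast
  qed
  show "\<not> bdd_above ?S"
  proof
    assume "bdd_above ?S"
    then obtain B where B: "\<And>t. t \<in> ?S \<Longrightarrow> t \<le> B" unfolding bdd_above_def by blast
    obtain \<gamma> where "\<gamma> \<in> hecke_group q" "strip (g ** \<gamma>)" "B + 1 \<le> slope (g ** \<gamma>)"
      using strip_slopes(1)[OF assms] by blast
    with B[OF ret] show False by force
  qed
  show "\<not> bdd_below ?S"
  proof
    assume "bdd_below ?S"
    then obtain B where B: "\<And>t. t \<in> ?S \<Longrightarrow> B \<le> t" unfolding bdd_below_def by blast
    obtain \<gamma> where "\<gamma> \<in> hecke_group q" "strip (g ** \<gamma>)" "slope (g ** \<gamma>) \<le> B - 1"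
      using strip_slopes(2)[OF assms] by blast
    with B[OF ret] show False by force
  qed
qed

subsection \<open>The geodesic flow\<close>

definition side_section :: "(real^2^2) set set" where
  "side_section = {coset_of q (Phi u v) | u v.
     (u, v) \<in> FQFQ \<and> (\<exists>a. 0 < a \<and> a < 1 \<and> u = vector [a, 1 - a])}"

lemma geodesic_flow_coset: "geodesic_flow t (coset_of q g) = coset_of q (g_mat t ** g)"
  by (simp add: geodesic_flow_def l_coset_coset_of)

lemma det_Phi: "(u, v) \<in> FQFQ \<Longrightarrow> det (Phi u v) = 1"
  by (simp add: FQFQ_def Phi_m2 inner_vec_def sum_2)

lemma side_section_subset: "side_section \<subseteq> hecke_space q"
proof
  fix x assume "x \<in> side_section"
  then obtain u v where "(u, v) \<in> FQFQ" "x = coset_of q (Phi u v)"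
    by (auto simp: side_section_def)
  then show "x \<in> hecke_space q" using det_Phi by (auto simp: hecke_space_iff)
qed

text \<open>The flow scales the first row by e^t and keeps all signs, so a crossed side stays
  crossed and has row sum 1 at exactly one time.\<close>

lemma geodesic_returns:
  assumes g: "det g = 1"
  shows "{t. geodesic_flow t (coset_of q g) \<in> side_section} =
    {- ln (rowsum (g ** \<gamma>)) | \<gamma>. \<gamma> \<in> hecke_group q \<and> crossing (g ** \<gamma>)}"
proof (intro equalityI subsetI)
  fix t assume "t \<in> {t. geodesic_flow t (coset_of q g) \<in> side_section}"
  then obtain u v a where uv: "(u, v) \<in> FQFQ" "0 < a" "a < 1" "u = vector [a, 1 - a]"
    "coset_of q (g_mat t ** g) = coset_of q (Phi u v)"
    by (auto simp: geodesic_flow_coset side_section_def)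
  have "det (g_mat t ** g) = 1"
    using g by (simp add: det_mul g_mat_m2 exp_minus)
  then obtain \<gamma> where \<gamma>: "\<gamma> \<in> hecke_group q" "Phi u v = g_mat t ** (g ** \<gamma>)"
    using uv(5) det_Phi[OF uv(1)] by (auto simp: coset_of_eq_iff matrix_mul_assoc)
  obtain p r s w where X: "g ** \<gamma> = m2 p r s w" by (rule m2_cases)
  have eqs: "a = exp t * p" "1 - a = exp t * r" "- v $ 2 = exp (- t) * s" "v $ 1 = exp (- t) * w"
    using \<gamma>(2) by (simp_all add: X g_mat_m2 Phi_m2 uv(4))
  have "0 < exp t * p" "0 < exp t * r" "exp (- t) * s \<le> 0" "0 < exp (- t) * w"
    using uv(1-3) unfolding eqs[symmetric] by (auto simp: FQFQ_def FQ_def)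
  then have pos: "0 < p" "0 < r" "s \<le> 0" "0 < w"
    by (simp_all add: zero_less_mult_iff mult_le_0_iff)
  then have "crossing (g ** \<gamma>)" by (simp add: X crossing_def)
  moreover have "exp t * (p + r) = 1" using eqs(1,2) by (simp add: algebra_simps)
  then have "ln (exp t * (p + r)) = 0" by simp
  then have "t = - ln (rowsum (g ** \<gamma>))"
    using pos by (simp add: ln_mult rowsum_def X)
  ultimately show "t \<in> {- ln (rowsum (g ** \<gamma>)) | \<gamma>. \<gamma> \<in> hecke_group q \<and> crossing (g ** \<gamma>)}"
    using \<gamma>(1) by blast
next
  fix t assume "t \<in> {- ln (rowsum (g ** \<gamma>)) | \<gamma>. \<gamma> \<in> hecke_group q \<and> crossing (g ** \<gamma>)}"
  then obtain \<gamma> where \<gamma>: "\<gamma> \<in> hecke_group q" "crossing (g ** \<gamma>)" "t = - ln (rowsum (g ** \<gamma>))"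
    by blast
  obtain p r s w where X: "g ** \<gamma> = m2 p r s w" by (rule m2_cases)
  have pos: "0 < p" "0 < r" "s \<le> 0" "0 < w" using \<gamma>(2) by (simp_all add: X crossing_def)
  have "det (g ** \<gamma>) = 1" using g hecke_group_det[OF \<gamma>(1)] by (simp add: det_mul)
  then have det: "p * w - r * s = 1" by (simp add: X)
  have "exp t = inverse (p + r)" using pos by (simp add: \<gamma>(3) X rowsum_def exp_minus)
  then have one: "exp t * p + exp t * r = 1" using pos by (simp add: field_simps)
  define u v where uv: "u = (vector [exp t * p, exp t * r] :: real^2)"
    "v = (vector [exp (- t) * w, - (exp (- t) * s)] :: real^2)"
  have "u \<bullet> v = exp t * exp (- t) * (p * w - r * s)"
    by (simp add: uv inner_vec_def sum_2 algebra_simps)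
  then have "(u, v) \<in> FQFQ"
    using pos det by (simp add: FQFQ_def FQ_def uv mult_nonneg_nonpos exp_minus)
  moreover have "0 < exp t * p \<and> exp t * p < 1 \<and> u = vector [exp t * p, 1 - exp t * p]"
  proof (intro conjI)
    have "exp t * r = 1 - exp t * p" using one by simp
    then show "u = vector [exp t * p, 1 - exp t * p]" by (simp add: uv)
    have "0 < exp t * r" using pos by simp
    then show "exp t * p < 1" using one by linarith
  qed (use pos in simp)
  moreover have "Phi u v = g_mat t ** (g ** \<gamma>)"
    by (simp add: Phi_m2 uv X g_mat_m2)
  then have "geodesic_flow t (coset_of q g) = coset_of q (Phi u v)"
    using coset_of_mult[OF g \<gamma>(1)] by (metis geodesic_flow_coset)
  ultimately show "t \<in> {t. geodesic_flow t (coset_of q g) \<in> side_section}"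
    unfolding side_section_def by blast
qed

text \<open>In one direction row sums grow by at least the smaller entry of the first row. In the
  other they are at most that of an immediate predecessor \<open>X ** m2_adj (W j)\<close>, of which
  there are finitely many.\<close>

lemma crossing_gap:
  assumes X: "crossing X"
  obtains \<eta> where "0 < \<eta>" "\<And>\<gamma>. \<gamma> \<in> hecke_group q \<Longrightarrow> crossing (X ** \<gamma>) \<Longrightarrow>
    X ** \<gamma> = X \<or> \<eta> \<le> \<bar>rowsum (X ** \<gamma>) - rowsum X\<bar>"
proof -
  define F where "F = {r \<in> (\<lambda>j. rowsum (X ** m2_adj (W j))) ` {0<..<int q}. r < rowsum X}"
  have "finite F" by (simp add: F_def)
  \<comment> \<open>Inserting 1 keeps the minimum meaningful when \<open>F\<close> is empty.\<close>
  define \<eta>1 where "\<eta>1 = Min (insert 1 ((\<lambda>r. rowsum X - r) ` F))"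
  define \<eta>2 where "\<eta>2 = min (X $ 1 $ 1) (X $ 1 $ 2)"
  have pos: "0 < X $ 1 $ 1" "0 < X $ 1 $ 2" using X by (auto simp: crossing_def)
  have \<eta>1: "0 < \<eta>1" "\<And>r. r \<in> F \<Longrightarrow> \<eta>1 \<le> rowsum X - r"
    using \<open>finite F\<close> by (auto simp: \<eta>1_def F_def)
  have \<eta>2: "0 < \<eta>2" using pos by (simp add: \<eta>2_def)
  have "X ** \<gamma> = X \<or> \<eta>1 \<le> \<bar>rowsum (X ** \<gamma>) - rowsum X\<bar> \<or> \<eta>2 \<le> \<bar>rowsum (X ** \<gamma>) - rowsum X\<bar>"
    if \<gamma>: "\<gamma> \<in> hecke_group q" "crossing (X ** \<gamma>)" for \<gamma>
    using X \<gamma>(2,1)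
  proof (cases rule: crossing_related)
    case 1
    then show ?thesis
    proof cases
      case one
      then show ?thesis by simp
    next
      case (step j A)
      have "rowsum X + \<eta>2 \<le> rowsum (X ** W j)"
        unfolding \<eta>2_def by (rule rowsum_W(3)[OF step(2,3) pos])
      also have "\<dots> \<le> rowsum (X ** W j ** A)"
        using rowsum_Mon[OF step(4) rowsum_W(1,2)[OF step(2,3) pos]] by simp
      finally have "\<eta>2 \<le> \<bar>rowsum (X ** W j ** A) - rowsum X\<bar>" by linarith
      then show ?thesis by (simp add: step(1) matrix_mul_assoc)
    qed
  next
    case (2 A)
    have Ypos: "0 < (X ** \<gamma>) $ 1 $ 1" "0 < (X ** \<gamma>) $ 1 $ 2"
      using \<gamma>(2) by (auto simp: crossing_def)
    show ?thesis
      using 2(1)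
    proof (cases rule: Mon_right_cases)
      case 1
      then show ?thesis using 2(2)[symmetric] by simp
    next
      case (2 j B)
      define Z where "Z = X ** \<gamma> ** B"
      have Z: "0 < Z $ 1 $ 1" "0 < Z $ 1 $ 2" "rowsum (X ** \<gamma>) \<le> rowsum Z"
        using rowsum_Mon[OF 2(3) Ypos] by (auto simp: Z_def)
      have ZX: "Z ** W j = X"
        using \<open>X = X ** \<gamma> ** A\<close>[symmetric] by (simp add: Z_def 2(4) matrix_mul_assoc)
      have "Z = Z ** W j ** m2_adj (W j)"
        using m2_adj_inverse[OF det_W[of j]] by (simp flip: matrix_mul_assoc)
      then have "rowsum Z = rowsum (X ** m2_adj (W j))" by (simp add: ZX)
      moreover have "rowsum Z < rowsum X"
        using rowsum_W(3)[OF 2(1,2) Z(1,2)] Z by (simp add: ZX)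
      ultimately have "rowsum Z \<in> F" using 2(1,2) by (auto simp: F_def)
      then show ?thesis using \<eta>1(2) Z(3) by fastforce
    qed
  qed
  then show thesis
    using that[of "min \<eta>1 \<eta>2"] \<eta>1(1) \<eta>2 by (auto simp: min_le_iff_disj)
qed

lemma geodesic_returns_discrete:
  assumes g: "det g = 1"
  shows "discrete {t. geodesic_flow t (coset_of q g) \<in> side_section}"
  unfolding geodesic_returns[OF g]
proof (rule discreteI)
  let ?S = "{- ln (rowsum (g ** \<gamma>)) | \<gamma>. \<gamma> \<in> hecke_group q \<and> crossing (g ** \<gamma>)}"
  fix t assume t: "t \<in> ?S"
  then obtain \<gamma> where \<gamma>: "\<gamma> \<in> hecke_group q" "crossing (g ** \<gamma>)" "t = - ln (rowsum (g ** \<gamma>))" by blast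
  obtain \<eta> where \<eta>: "0 < \<eta>" "\<And>\<delta>. \<delta> \<in> hecke_group q \<Longrightarrow> crossing (g ** \<gamma> ** \<delta>) \<Longrightarrow>
    g ** \<gamma> ** \<delta> = g ** \<gamma> \<or> \<eta> \<le> \<bar>rowsum (g ** \<gamma> ** \<delta>) - rowsum (g ** \<gamma>)\<bar>"
    using crossing_gap[OF \<gamma>(2)] by blast
  \<comment> \<open>The gap concerns row sums exp(-s); continuity pulls it back to times.\<close>
  let ?T = "{s. \<bar>exp (- s) - rowsum (g ** \<gamma>)\<bar> < \<eta>}"
  have exp: "exp (- (- ln (rowsum X))) = rowsum X" if "crossing X" for X
    using that by (simp add: crossing_def rowsum_def)
  have "open ?T" by (intro open_Collect_less continuous_intros)
  moreover have "s = t" if s: "s \<in> ?T" "s \<in> ?S" for s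
  proof -
    obtain \<delta> where \<delta>: "\<delta> \<in> hecke_group q" "crossing (g ** \<delta>)" "s = - ln (rowsum (g ** \<delta>))"
      using s(2) by blast
    have "\<gamma> ** m2_adj \<gamma> = mat 1" using m2_adj_inverse hecke_group_det[OF \<gamma>(1)] by blast
    then have eq: "g ** \<gamma> ** (m2_adj \<gamma> ** \<delta>) = g ** \<delta>"
      by (metis matrix_mul_assoc matrix_mul_lid)
    have "m2_adj \<gamma> ** \<delta> \<in> hecke_group q" using hecke_group_mult hecke_group_adj \<gamma>(1) \<delta>(1) by blast
    then have "g ** \<delta> = g ** \<gamma> \<or> \<eta> \<le> \<bar>rowsum (g ** \<delta>) - rowsum (g ** \<gamma>)\<bar>"
      using \<eta>(2)[of "m2_adj \<gamma> ** \<delta>"] \<delta>(2) by (simp add: eq)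
    then show ?thesis
      using s(1) exp[OF \<delta>(2)] \<delta>(3) \<gamma>(3) by auto
  qed
  moreover have "t \<in> ?T" using \<eta>(1) exp[OF \<gamma>(2)] \<gamma>(3) by simp
  ultimately show "t isolated_in ?S"
    using t by (intro isolated_inI[of _ _ ?T]) blast+
qed

lemma geodesic_returns_unbounded:
  assumes g: "det g = 1"
    and nz: "\<And>\<gamma>. \<gamma> \<in> hecke_group q \<Longrightarrow> (g ** \<gamma>) $ 1 $ 1 \<noteq> 0 \<and> (g ** \<gamma>) $ 2 $ 1 \<noteq> 0"
  shows "\<not> bdd_above {t. geodesic_flow t (coset_of q g) \<in> side_section}"
    and "\<not> bdd_below {t. geodesic_flow t (coset_of q g) \<in> side_section}"
proof -
  let ?S = "{t. geodesic_flow t (coset_of q g) \<in> side_section}"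
  define K where "K = 4 / (2 - lam)"
  have K: "0 < K" using lam_less_2 by (simp add: K_def)
  have det: "det (g_mat t) = 1" for t by (simp add: g_mat_m2 exp_minus)
  show "\<not> bdd_above ?S"
  proof
    assume "bdd_above ?S"
    then obtain B where B: "\<And>t. t \<in> ?S \<Longrightarrow> t \<le> B" unfolding bdd_above_def by blast
    \<comment> \<open>A side with row sum at most \<open>K\<close> at time \<open>t\<close> has
      return time at least t - ln K = B + 1.\<close>
    define t where "t = B + ln K + 1"
    have "(g_mat t ** g ** \<gamma>) $ 1 $ 1 \<noteq> 0" if "\<gamma> \<in> hecke_group q" for \<gamma>
      using nz[OF that]
      by (simp add: matrix_mult_2_nth[where A = "m2 a b c d" for a b c d] g_mat_m2 flip: matrix_mul_assoc)
    then obtain \<gamma> where \<gamma>: "\<gamma> \<in> hecke_group q" "crossing (g_mat t ** g ** \<gamma>)" "rowsum (g_mat t ** g ** \<gamma>) \<le> K"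
      using small_crossing[of "g_mat t ** g"] g det by (auto simp: det_mul K_def)
    obtain p r s w where X: "g ** \<gamma> = m2 p r s w" by (rule m2_cases)
    have gX: "g_mat t ** g ** \<gamma> = m2 (exp t * p) (exp t * r) (exp (- t) * s) (exp (- t) * w)"
      by (simp add: X g_mat_m2 flip: matrix_mul_assoc)
    have pos: "0 < p" "0 < r" "s \<le> 0" "0 < w"
      using \<gamma>(2) by (simp_all add: gX crossing_def zero_less_mult_iff mult_le_0_iff)
    have "exp t * (p + r) \<le> K" using \<gamma>(3) by (simp add: gX rowsum_def algebra_simps)
    then have "ln (exp t * (p + r)) \<le> ln K" using pos K by (subst ln_le_cancel_iff) auto
    then have "t + ln (p + r) \<le> ln K" using pos by (simp add: ln_mult)
    moreover have "crossing (g ** \<gamma>)" using pos by (simp add: crossing_def X)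
    then have "- ln (rowsum (g ** \<gamma>)) \<in> ?S"
      unfolding geodesic_returns[OF g] using \<gamma>(1) by blast
    then have "- ln (p + r) \<le> B" using B by (simp add: X rowsum_def)
    ultimately show False by (simp add: t_def)
  qed
  show "\<not> bdd_below ?S"
  proof
    assume "bdd_below ?S"
    then obtain B where B: "\<And>t. t \<in> ?S \<Longrightarrow> B \<le> t" unfolding bdd_below_def by blast
    define t where "t = B - ln K - 1"
    \<comment> \<open>S interchanges the axes and so reverses the geodesic;
      \<open>small_crossing\<close> then bounds the second row.\<close>
    define h where "h = hecke_S ** g_mat t"
    have h: "h = m2 0 (- exp (- t)) (exp t) 0" by (simp add: h_def hecke_S_m2 g_mat_m2)
    have "(h ** g ** \<gamma>) $ 1 $ 1 \<noteq> 0" if "\<gamma> \<in> hecke_group q" for \<gamma>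
      using nz[OF that]
      by (simp add: matrix_mult_2_nth[where A = "m2 a b c d" for a b c d] h flip: matrix_mul_assoc)
    then obtain \<gamma> where \<gamma>: "\<gamma> \<in> hecke_group q" "crossing (h ** g ** \<gamma>)" "rowsum (h ** g ** \<gamma>) \<le> K"
      using small_crossing[of "h ** g"] g by (auto simp: det_mul K_def h exp_minus)
    obtain p r s w where X: "g ** \<gamma> = m2 p r s w" by (rule m2_cases)
    have hX: "h ** g ** \<gamma> = m2 (exp (- t) * (- s)) (exp (- t) * (- w)) (exp t * p) (exp t * r)"
      by (simp add: X h flip: matrix_mul_assoc)
    \<comment> \<open>The crossing gives only p \<le> 0, but a crossing for \<gamma>S needs the
      strict sign.\<close>
    have "p \<noteq> 0" using nz[OF \<gamma>(1)] by (simp add: X)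
    moreover have "p \<le> 0" "0 < r" "s < 0" "w < 0"
      using \<gamma>(2) by (simp_all add: hX crossing_def zero_less_mult_iff mult_le_0_iff mult_less_0_iff)
    ultimately have pos: "0 < - p" "0 < r" "0 < - s" "0 < - w" by auto
    have "det (g ** \<gamma>) = 1" using g hecke_group_det[OF \<gamma>(1)] by (simp add: det_mul)
    then have dt: "p * w - r * s = 1" by (simp add: X)
    have Y: "g ** (\<gamma> ** hecke_S) = m2 r (- p) w (- s)"
      by (simp add: matrix_mul_assoc X hecke_S_m2)
    have "crossing (g ** (\<gamma> ** hecke_S))" using pos by (simp add: crossing_def Y)
    then have "- ln (rowsum (g ** (\<gamma> ** hecke_S))) \<in> ?S"
      unfolding geodesic_returns[OF g] using hecke_group_mult[OF \<gamma>(1) hecke_group_S] by blast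
    then have "B \<le> - ln (r - p)" using B by (simp add: Y rowsum_def)
    moreover have "exp (- t) * (- s - w) \<le> K" using \<gamma>(3) by (simp add: hX rowsum_def algebra_simps)
    then have "ln (exp (- t) * (- s - w)) \<le> ln K" using pos K by (subst ln_le_cancel_iff) auto
    then have "- t + ln (- s - w) \<le> ln K" using pos by (simp add: ln_mult)
    \<comment> \<open>Determinant 1 turns the upper bound on the second row into a lower bound on
      the row sum.\<close>
    moreover have "1 \<le> (r - p) * (- s - w)"
    proof -
      have "0 \<le> r * (- w)" "0 \<le> (- p) * (- s)"
        by (rule mult_nonneg_nonneg; use pos in simp)+
      then show ?thesis using dt by (simp add: algebra_simps)
    qed
    then have "0 \<le> ln ((r - p) * (- s - w))" by simp
    then have "0 \<le> ln (r - p) + ln (- s - w)" using pos by (simp add: ln_mult)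
    ultimately show False by (simp add: t_def)
  qed
qed

section \<open>Assembly of the cross sections\<close>

lemma cross_sectionI:
  assumes M: "is_haar_prob q M" and "\<Omega> \<subseteq> hecke_space q"
    and "\<And>g. det g = 1 \<Longrightarrow> (\<And>\<gamma>. \<gamma> \<in> hecke_group q \<Longrightarrow> (g ** \<gamma>) $ 1 $ 1 \<noteq> 0 \<and> (g ** \<gamma>) $ 2 $ 1 \<noteq> 0) \<Longrightarrow>
      discrete {t. \<phi> t (coset_of q g) \<in> \<Omega>} \<and> \<not> bdd_above {t. \<phi> t (coset_of q g) \<in> \<Omega>} \<and>
      \<not> bdd_below {t. \<phi> t (coset_of q g) \<in> \<Omega>}"
  shows "cross_section M \<phi> \<Omega>"
proof -
  have space: "space M = hecke_space q" using M by (simp add: is_haar_prob_def)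
  have "AE x in M. discrete {t. \<phi> t x \<in> \<Omega>} \<and> \<not> bdd_above {t. \<phi> t x \<in> \<Omega>} \<and> \<not> bdd_below {t. \<phi> t x \<in> \<Omega>}"
    using AE_axes_avoided[OF M]
  proof (rule AE_mp, intro AE_I2 impI)
    fix x assume "x \<in> space M"
      and ax: "\<forall>g. det g = 1 \<longrightarrow> x = coset_of q g \<longrightarrow> g $ 1 $ 1 \<noteq> 0 \<and> g $ 2 $ 1 \<noteq> 0"
    then obtain g where g: "det g = 1" "x = coset_of q g" by (auto simp: space hecke_space_iff)
    \<comment> \<open>All \<open>g ** \<gamma>\<close> represent the same coset, so the condition
      covers every vector of the orbit.\<close>
    have "(g ** \<gamma>) $ 1 $ 1 \<noteq> 0 \<and> (g ** \<gamma>) $ 2 $ 1 \<noteq> 0" if "\<gamma> \<in> hecke_group q" for \<gamma>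
      using ax g coset_of_mult[OF g(1) that] hecke_group_det[OF that] by (simp add: det_mul)
    from assms(3)[OF g(1) this]
    show "discrete {t. \<phi> t x \<in> \<Omega>} \<and> \<not> bdd_above {t. \<phi> t x \<in> \<Omega>} \<and> \<not> bdd_below {t. \<phi> t x \<in> \<Omega>}"
      by (simp add: g(2))
  qed
  then show ?thesis using assms(2) by (simp add: cross_section_def space)
qed

lemma cross_section_polygon:
  assumes "is_haar_prob q M"
  shows "cross_section M horocycle_flow polygon_section"
  using horocycle_returns_discrete horocycle_returns_unbounded
  by (intro cross_sectionI[OF assms polygon_section_subset] conjI) auto

lemma cross_section_side:
  assumes "is_haar_prob q M"
  shows "cross_section M geodesic_flow side_section"
  using geodesic_returns_discrete geodesic_returns_unbounded
  by (intro cross_sectionI[OF assms side_section_subset] conjI) auto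

end

theorem proposition1p2:
  fixes q :: nat and M :: "(real^2^2) set measure"
  assumes "q \<ge> 3" and "is_haar_prob q M"
  shows "bij_betw (\<lambda>(u, v). coset_of q (Phi u v)) (SP q)
           (suspension_coset q ` farey_suspension q) \<and>
         cross_section M horocycle_flow
           {coset_of q (g_upper (u $ 1) (u $ 2)) | u. u \<in> hecke_polygon q} \<and>
         cross_section M geodesic_flow
           {coset_of q (Phi u v) | u v.
              (u, v) \<in> FQFQ \<and> (\<exists>a. 0 < a \<and> a < 1 \<and> u = vector [a, 1 - a])}"
proof -
  interpret hecke q by unfold_locales (rule assms(1))
  show ?thesis
    using bij_betw_SP cross_section_polygon[OF assms(2)] cross_section_side[OF assms(2)]
    by (simp add: polygon_section_def side_section_def)
qed

end
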